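(* Let $V$ be a finite-dimensional irreducible $\mathcal{A}$-module of diameter $d$ and let $\sigma\in G$. Then the following (i), (ii) hold. (i) If $V$ is of type $B(d)$, then ${}^{\sigma}V$ is of type $B(d)$. (ii) If $V$ is of type $AB(d,n)$ for some $n\in\mathbb{I}$, then ${}^{\sigma}V$ is of type $AB(d,\tilde{\sigma}(n))$.
   Context: $\mathbb{K}$ is an algebraically closed field of characteristic zero. $\mathcal{A}$ is the unital associative $\mathbb{K}$-algebra with generators $x,y,z$ and relations $xy+yx=2z$, $yz+zy=2x$, $zx+xz=2y$. The diameter of a finite-dimensional irreducible module $V$ is $\dim V-1$. $\mathbb{I}=\{0,x,y,z\}$ is a set of four symbols. $G$ is the group of $\mathbb{K}$-algebra automorphisms of $\mathcal{A}$ that map the set $\{\pm x,\pm y,\pm z\}$ to itself. Put $h_0=x+y+z$, $h_x=x-y-z$, $h_y=-x+y-z$, $h_z=-x-y+z$. Each $\sigma\in G$ permutes $\{h_n\}_{n\in\mathbb{I}}$, and $\tilde\sigma$ is the permutation of $\mathbb{I}$ with $\sigma(h_n)=h_{\tilde\sigma(n)}$ for all $n\in\mathbb{I}$. For an automorphism $\sigma$ of $\mathcal{A}$ and an $\mathcal{A}$-module $V$, the twisted module ${}^\sigma V$ is the vector space $V$ on which $a\in\mathcal{A}$ acts as $\sigma^{-1}(a)$ acts on the original module $V$. Type $B(d)$ ($d\ge 0$ even): an $\mathcal{A}$-module is of type $B(d)$ if it is isomorphic to the irreducible module with basis $\{v_i\}_{i=0}^d$ and, for $0\le i\le d$: $x.v_i=(-1)^i(d-2i)v_i$,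 $y.v_i=(d-i+1)v_{i-1}+(i+1)v_{i+1}$, $z.v_i=(-1)^{i-1}(d-i+1)v_{i-1}+(-1)^i(i+1)v_{i+1}$, with $v_{-1}=0=v_{d+1}$. Type $AB(d,n)$ ($d\ge 0$ an integer, $n\in\mathbb{I}$): for $a\in\{x,y,z\}$ put $\widehat a(n)=1$ if $n\in\{0,a\}$ and $\widehat a(n)=-1$ otherwise. An $\mathcal{A}$-module is of type $AB(d,n)$ if it is isomorphic to the irreducible module with basis $\{v_i\}_{i=0}^d$ and, for $0\le i\le d$: $x.v_i=\widehat x(n)(-1)^{d+i}(2d-2i+1)v_i$, $y.v_i=\widehat y(n)(-1)^d\big((2d-i+2)v_{i-1}+(i+1)v_{i+1}\big)$, $z.v_i=\widehat z(n)\big((-1)^{i-1}(2d-i+2)v_{i-1}+(-1)^i(i+1)v_{i+1}\big)$, with $v_{-1}=0$, $v_{d+1}=v_d$. *)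

theory Defs
  imports
    "HOL-Library.Poly_Mapping"
    "HOL-Computational_Algebra.Polynomial"
    "HOL-Combinatorics.Permutations"
begin

section \<open>The algebra\<close>

datatype gen = GX | GY | GZ

text \<open>Words in the generators, as an additively written free monoid, so that
  \<open>word \<Rightarrow>\<^sub>0 'k\<close> with its convolution product is the free unital associative algebra.\<close>

datatype word = Word (letters: "gen list")

instantiation word :: monoid_add
begin

definition zero_word :: word where "0 = Word []"

definition plus_word :: "word \<Rightarrow> word \<Rightarrow> word" where
  "u + w = Word (letters u @ letters w)"

instance
  by standard (simp_all add: zero_word_def plus_word_def)

end

type_synonym 'k free_alg = "word \<Rightarrow>\<^sub>0 'k"

definition free_gen :: "gen \<Rightarrow> 'k::field free_alg" where
  "free_gen g = Poly_Mapping.single (Word [g]) 1"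

definition relators :: "'k::field free_alg set" where
  "relators =
    {free_gen GX * free_gen GY + free_gen GY * free_gen GX - 2 * free_gen GZ,
     free_gen GY * free_gen GZ + free_gen GZ * free_gen GY - 2 * free_gen GX,
     free_gen GZ * free_gen GX + free_gen GX * free_gen GZ - 2 * free_gen GY}"

inductive_set rel_ideal :: "'k::field free_alg set" where
  zero: "0 \<in> rel_ideal"
| base: "r \<in> relators \<Longrightarrow> p * r * q \<in> rel_ideal"
| add: "a \<in> rel_ideal \<Longrightarrow> b \<in> rel_ideal \<Longrightarrow> a + b \<in> rel_ideal"

lemma rel_ideal_mult_left: "a \<in> rel_ideal \<Longrightarrow> p * a \<in> rel_ideal"
proof (induction rule: rel_ideal.induct)
  case (base r p' q)
  then show ?case
    using rel_ideal.base[of r "p * p'" q] by (simp add: mult.assoc)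
qed (auto simp: distrib_left intro: rel_ideal.intros)

lemma rel_ideal_mult_right: "a \<in> rel_ideal \<Longrightarrow> a * p \<in> rel_ideal"
proof (induction rule: rel_ideal.induct)
  case (base r p' q)
  then show ?case
    using rel_ideal.base[of r p' "q * p"] by (simp add: mult.assoc)
qed (auto simp: distrib_right intro: rel_ideal.intros)

lemma rel_ideal_uminus: "a \<in> rel_ideal \<Longrightarrow> - a \<in> rel_ideal"
  using rel_ideal_mult_left[of a "- 1"] by simp

lemma rel_ideal_diff: "a \<in> rel_ideal \<Longrightarrow> b \<in> rel_ideal \<Longrightarrow> a - b \<in> rel_ideal"
  using rel_ideal.add[OF _ rel_ideal_uminus, of a b] by simp

lemma add_word_eq_zero_iff: "0 = u + w \<longleftrightarrow> u = 0 \<and> w = (0::word)"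
  by (cases u; cases w) (auto simp: zero_word_def plus_word_def)

lemma lookup_mult_zero_word:
  fixes f g :: "'k::field free_alg"
  shows "Poly_Mapping.lookup (f * g) 0 = Poly_Mapping.lookup f 0 * Poly_Mapping.lookup g 0"
proof -
  have "(\<Sum>q. Poly_Mapping.lookup g q when (0::word) = l + q)
      = (Poly_Mapping.lookup g 0 when l = 0)" for l
  proof (cases "l = 0")
    case True
    then show ?thesis by simp
  next
    case False
    then show ?thesis by (simp add: add_word_eq_zero_iff)
  qed
  then show ?thesis by (simp add: lookup_mult mult_when)
qed

lemma lookup_free_gen_zero_word: "Poly_Mapping.lookup (free_gen g) 0 = 0"
  by (simp add: free_gen_def lookup_single zero_word_def)

lemma lookup_rel_ideal_zero_word: "a \<in> rel_ideal \<Longrightarrow> Poly_Mapping.lookup a 0 = 0"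
proof (induction rule: rel_ideal.induct)
  case (base r p q)
  then have "Poly_Mapping.lookup r 0 = 0"
    by (auto simp: relators_def lookup_add lookup_minus lookup_mult_zero_word
        lookup_free_gen_zero_word)
  then show ?case by (simp add: lookup_mult_zero_word)
qed (simp_all add: lookup_add)

lemma equivp_rel_ideal: "equivp (\<lambda>p q :: 'k::field free_alg. p - q \<in> rel_ideal)"
proof (rule equivpI)
  show "reflp (\<lambda>p q :: 'k free_alg. p - q \<in> rel_ideal)"
    by (rule reflpI) (simp add: rel_ideal.zero)
  show "symp (\<lambda>p q :: 'k free_alg. p - q \<in> rel_ideal)"
    by (rule sympI) (use rel_ideal_uminus in fastforce)
  show "transp (\<lambda>p q :: 'k free_alg. p - q \<in> rel_ideal)"
    by (rule transpI) (use rel_ideal.add in fastforce)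
qed

quotient_type (overloaded) 'k calA = "'k::field free_alg" / "\<lambda>p q. p - q \<in> rel_ideal"
  by (rule equivp_rel_ideal)

instantiation calA :: (field) ring_1
begin

lift_definition zero_calA :: "'a calA" is 0 .
lift_definition one_calA :: "'a calA" is 1 .
lift_definition plus_calA :: "'a calA \<Rightarrow> 'a calA \<Rightarrow> 'a calA" is "(+)"
  using rel_ideal.add by (fastforce simp: algebra_simps)
lift_definition uminus_calA :: "'a calA \<Rightarrow> 'a calA" is uminus
  using rel_ideal_uminus by fastforce
lift_definition minus_calA :: "'a calA \<Rightarrow> 'a calA \<Rightarrow> 'a calA" is "(-)"
  using rel_ideal_diff by (fastforce simp: algebra_simps)
lift_definition times_calA :: "'a calA \<Rightarrow> 'a calA \<Rightarrow> 'a calA" is "(*)"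
proof -
  fix p p' q q' :: "'a free_alg"
  assume "p - p' \<in> rel_ideal" "q - q' \<in> rel_ideal"
  then have "(p - p') * q + p' * (q - q') \<in> rel_ideal"
    by (intro rel_ideal.add rel_ideal_mult_left rel_ideal_mult_right)
  then show "p * q - p' * q' \<in> rel_ideal"
    by (simp add: algebra_simps)
qed

instance
proof
  show "(0::'a calA) \<noteq> 1"
  proof transfer
    have False if "- 1 \<in> (rel_ideal :: 'a free_alg set)"
      using lookup_rel_ideal_zero_word[OF that] by (simp add: lookup_one)
    then show "\<not> 0 - 1 \<in> (rel_ideal :: 'a free_alg set)" by auto
  qed
qed (transfer; simp add: algebra_simps rel_ideal.zero)+

end

lift_definition scaleA :: "'k::field \<Rightarrow> 'k calA \<Rightarrow> 'k calA"
  is "\<lambda>c p. Poly_Mapping.single 0 c * p"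
  by (simp add: rel_ideal_mult_left flip: right_diff_distrib)

lift_definition genA :: "gen \<Rightarrow> 'k::field calA" is free_gen .

abbreviation "xA \<equiv> genA GX"
abbreviation "yA \<equiv> genA GY"
abbreviation "zA \<equiv> genA GZ"

lemma calA_relations:
  "xA * yA + yA * xA = 2 * (zA :: 'k::field calA)"
  "yA * zA + zA * yA = 2 * (xA :: 'k::field calA)"
  "zA * xA + xA * zA = 2 * (yA :: 'k::field calA)"
proof -
  have *: "r \<in> rel_ideal" if "r \<in> relators" for r :: "'k free_alg"
    using rel_ideal.base[OF that, of 1 1] by simp
  have two: "(2 :: 'k calA) = 1 + 1" "(2 :: 'k free_alg) = 1 + 1" by simp_all
  show "xA * yA + yA * xA = 2 * (zA :: 'k::field calA)"
    unfolding two by transfer (rule *, simp add: relators_def flip: two)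
  show "yA * zA + zA * yA = 2 * (xA :: 'k::field calA)"
    unfolding two by transfer (rule *, simp add: relators_def flip: two)
  show "zA * xA + xA * zA = 2 * (yA :: 'k::field calA)"
    unfolding two by transfer (rule *, simp add: relators_def flip: two)
qed


section \<open>The group \<open>G\<close> and its action on indices\<close>

definition alg_automorphism :: "('k::field calA \<Rightarrow> 'k calA) \<Rightarrow> bool" where
  "alg_automorphism \<sigma> \<longleftrightarrow>
     bij \<sigma> \<and> \<sigma> 1 = 1 \<and>
     (\<forall>a b. \<sigma> (a + b) = \<sigma> a + \<sigma> b) \<and>
     (\<forall>a b. \<sigma> (a * b) = \<sigma> a * \<sigma> b) \<and>
     (\<forall>c a. \<sigma> (scaleA c a) = scaleA c (\<sigma> a))"

definition G :: "('k::field calA \<Rightarrow> 'k calA) set" where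
  "G = {\<sigma>. alg_automorphism \<sigma> \<and>
            \<sigma> ` {xA, - xA, yA, - yA, zA, - zA} = {xA, - xA, yA, - yA, zA, - zA}}"

text \<open>The four symbols \<open>0, x, y, z\<close>.\<close>
datatype idx = I0 | Ix | Iy | Iz

fun h :: "idx \<Rightarrow> 'k::field calA" where
  "h I0 = xA + yA + zA"
| "h Ix = xA - yA - zA"
| "h Iy = - xA + yA - zA"
| "h Iz = - xA - yA + zA"

definition tilde :: "('k::field calA \<Rightarrow> 'k calA) \<Rightarrow> idx \<Rightarrow> idx" where
  "tilde \<sigma> = (THE \<pi>. \<pi> permutes UNIV \<and> (\<forall>n. \<sigma> (h n) = h (\<pi> n)))"


section \<open>Modules\<close>

text \<open>The underlying vector space of a module is a subspace \<open>carr M\<close> of an ambient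
  vector space that occupies a whole type; \<open>act M\<close> is only constrained on \<open>carr M\<close>.\<close>

record (overloaded) ('k::field, 'v::ab_group_add) amod =
  carr :: "'v set"
  smul :: "'k \<Rightarrow> 'v \<Rightarrow> 'v"
  act :: "'k calA \<Rightarrow> 'v \<Rightarrow> 'v"

definition is_amod :: "('k::field, 'v::ab_group_add) amod \<Rightarrow> bool" where
  "is_amod M \<longleftrightarrow>
     vector_space (smul M) \<and> module.subspace (smul M) (carr M) \<and>
     (\<forall>a. \<forall>v\<in>carr M. act M a v \<in> carr M) \<and>
     (\<forall>a. \<forall>u\<in>carr M. \<forall>v\<in>carr M. act M a (u + v) = act M a u + act M a v) \<and>
     (\<forall>a c. \<forall>v\<in>carr M. act M a (smul M c v) = smul M c (act M a v)) \<and>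
     (\<forall>a b. \<forall>v\<in>carr M. act M (a + b) v = act M a v + act M b v) \<and>
     (\<forall>c a. \<forall>v\<in>carr M. act M (scaleA c a) v = smul M c (act M a v)) \<and>
     (\<forall>a b. \<forall>v\<in>carr M. act M (a * b) v = act M a (act M b v)) \<and>
     (\<forall>v\<in>carr M. act M 1 v = v)"

definition submod :: "'v set \<Rightarrow> ('k::field, 'v::ab_group_add) amod \<Rightarrow> bool" where
  "submod U M \<longleftrightarrow>
     U \<subseteq> carr M \<and> module.subspace (smul M) U \<and> (\<forall>a. \<forall>u\<in>U. act M a u \<in> U)"

definition irreducible_amod :: "('k::field, 'v::ab_group_add) amod \<Rightarrow> bool" where
  "irreducible_amod M \<longleftrightarrow>
     is_amod M \<and> carr M \<noteq> {0} \<and> (\<forall>U. submod U M \<longrightarrow> U = {0} \<or> U = carr M)"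

definition finite_dim :: "('k::field, 'v::ab_group_add) amod \<Rightarrow> bool" where
  "finite_dim M \<longleftrightarrow> (\<exists>B. finite B \<and> module.span (smul M) B = carr M)"

definition diameter :: "('k::field, 'v::ab_group_add) amod \<Rightarrow> nat" where
  "diameter M = vector_space.dim (smul M) (carr M) - 1"

definition amod_iso ::
  "('k::field, 'v::ab_group_add) amod \<Rightarrow> ('k, 'w::ab_group_add) amod \<Rightarrow> bool" where
  "amod_iso M N \<longleftrightarrow> (\<exists>\<phi>. bij_betw \<phi> (carr M) (carr N) \<and>
     (\<forall>u\<in>carr M. \<forall>v\<in>carr M. \<phi> (u + v) = \<phi> u + \<phi> v) \<and>
     (\<forall>c. \<forall>v\<in>carr M. \<phi> (smul M c v) = smul N c (\<phi> v)) \<and>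
     (\<forall>a. \<forall>v\<in>carr M. \<phi> (act M a v) = act N a (\<phi> v)))"

definition twist ::
  "('k::field calA \<Rightarrow> 'k calA) \<Rightarrow> ('k, 'v::ab_group_add) amod \<Rightarrow> ('k, 'v) amod" where
  "twist \<sigma> M = M\<lparr>act := \<lambda>a v. act M (inv \<sigma> a) v\<rparr>"


section \<open>Types of modules\<close>

text \<open>Vectors are indexed by integers so that the boundary conventions for \<open>v (- 1)\<close> and
  \<open>v (d + 1)\<close> can be stated directly; only \<open>v 0, \<dots>, v d\<close> form the basis.\<close>

definition is_basis ::
  "('k::field, 'v::ab_group_add) amod \<Rightarrow> nat \<Rightarrow> (int \<Rightarrow> 'v) \<Rightarrow> bool" where
  "is_basis M d v \<longleftrightarrow>
     inj_on v {0..int d} \<and>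
     \<not> module.dependent (smul M) (v ` {0..int d}) \<and>
     module.span (smul M) (v ` {0..int d}) = carr M"

definition B_model ::
  "nat \<Rightarrow> ('k::field, 'v::ab_group_add) amod \<Rightarrow> (int \<Rightarrow> 'v) \<Rightarrow> bool" where
  "B_model d W v \<longleftrightarrow>
     irreducible_amod W \<and> is_basis W d v \<and> v (- 1) = 0 \<and> v (int d + 1) = 0 \<and>
     (\<forall>i\<in>{0..int d}.
        act W xA (v i) = smul W ((- 1) powi i * of_int (int d - 2 * i)) (v i) \<and>
        act W yA (v i) = smul W (of_int (int d - i + 1)) (v (i - 1))
                       + smul W (of_int (i + 1)) (v (i + 1)) \<and>
        act W zA (v i) = smul W ((- 1) powi (i - 1) * of_int (int d - i + 1)) (v (i - 1))
                       + smul W ((- 1) powi i * of_int (i + 1)) (v (i + 1)))"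

fun hat :: "gen \<Rightarrow> idx \<Rightarrow> 'k::field" where
  "hat GX n = (if n \<in> {I0, Ix} then 1 else - 1)"
| "hat GY n = (if n \<in> {I0, Iy} then 1 else - 1)"
| "hat GZ n = (if n \<in> {I0, Iz} then 1 else - 1)"

definition AB_model ::
  "nat \<Rightarrow> idx \<Rightarrow> ('k::field, 'v::ab_group_add) amod \<Rightarrow> (int \<Rightarrow> 'v) \<Rightarrow> bool" where
  "AB_model d n W v \<longleftrightarrow>
     irreducible_amod W \<and> is_basis W d v \<and> v (- 1) = 0 \<and> v (int d + 1) = v (int d) \<and>
     (\<forall>i\<in>{0..int d}.
        act W xA (v i) =
          smul W (hat GX n * (- 1) powi (int d + i) * of_int (2 * int d - 2 * i + 1)) (v i) \<and>
        act W yA (v i) =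
          smul W (hat GY n * (- 1) powi (int d))
            (smul W (of_int (2 * int d - i + 2)) (v (i - 1))
             + smul W (of_int (i + 1)) (v (i + 1))) \<and>
        act W zA (v i) =
          smul W (hat GZ n)
            (smul W ((- 1) powi (i - 1) * of_int (2 * int d - i + 2)) (v (i - 1))
             + smul W ((- 1) powi i * of_int (i + 1)) (v (i + 1))))"

text \<open>The model is taken inside \<open>nat \<Rightarrow>\<^sub>0 'k\<close>, which contains a vector space of every finite
  dimension over \<open>'k\<close>. Its basis and the action of the generators determine it up to
  isomorphism, so the choice of ambient space and scalar action is immaterial.\<close>

definition type_B :: "nat \<Rightarrow> ('k::field, 'v::ab_group_add) amod \<Rightarrow> bool" where
  "type_B d M \<longleftrightarrow> even d \<and> is_amod M \<and>
     (\<exists>(W :: ('k, nat \<Rightarrow>\<^sub>0 'k) amod) v. B_model d W v \<and> amod_iso M W)"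

definition type_AB :: "nat \<Rightarrow> idx \<Rightarrow> ('k::field, 'v::ab_group_add) amod \<Rightarrow> bool" where
  "type_AB d n M \<longleftrightarrow> is_amod M \<and>
     (\<exists>(W :: ('k, nat \<Rightarrow>\<^sub>0 'k) amod) v. AB_model d n W v \<and> amod_iso M W)"

end

theory Submission
  imports Defs
begin

text \<open>The twist of a model has the same underlying space, so it suffices to find, inside a model
  of type \<open>B(d)\<close> or \<open>AB(d,n)\<close>, another basis on which the images of \<open>x, y, z\<close> under
  \<open>inv \<sigma>\<close> act by the standard formulas. These images arise from \<open>x, y, z\<close> by swapping
  generators and by changing two signs. Sign changes, and the swap of \<open>y\<close> and \<open>z\<close>, only rescale
  the basis vectors, or alter \<open>n\<close>. For the swap of \<open>x\<close> and \<open>y\<close>, the vector \<open>v 0 + \<dots> + v d\<close> is an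
  eigenvector of \<open>y\<close> of extremal eigenvalue on which \<open>x\<close> and \<open>z\<close> agree. Applying
  \<open>x + z\<close>, \<open>x - z\<close>, \<open>x + z\<close>, \<dots> in turn yields eigenvectors of \<open>y\<close> with distinct
  eigenvalues, and the central element \<open>x\<^sup>2 + y\<^sup>2 + z\<^sup>2\<close> controls the operators that lead back.
  The boundary condition at the end of this chain is decided by comparing eigenvalues. Finally,
  \<open>n\<close> is tracked by \<open>h n = hat x n x + hat y n y + hat z n z\<close>.\<close>

section \<open>One-dimensional representations\<close>

definition word_weight :: "(gen \<Rightarrow> 'k::field) \<Rightarrow> word \<Rightarrow> 'k" where
  "word_weight \<chi> w = prod_list (map \<chi> (letters w))"

text \<open>The algebra homomorphism from the free algebra to the field that extends
  \<open>\<chi>\<close>; the sum over all words is finite because \<open>p\<close> has finite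
  support. It is the source of characters that tell elements of the quotient apart.\<close>

definition free_eval :: "(gen \<Rightarrow> 'k::field) \<Rightarrow> 'k free_alg \<Rightarrow> 'k" where
  "free_eval \<chi> p = (\<Sum>w. Poly_Mapping.lookup p w * word_weight \<chi> w)"

lemma word_weight_add: "word_weight \<chi> (u + w) = word_weight \<chi> u * word_weight \<chi> w"
  by (simp add: word_weight_def plus_word_def)

lemma free_eval_single: "free_eval \<chi> (Poly_Mapping.single w c) = c * word_weight \<chi> w"
  by (simp add: free_eval_def lookup_single when_mult)

lemma free_eval_zero: "free_eval \<chi> 0 = 0"
  by (simp add: free_eval_def)

lemma free_eval_add: "free_eval \<chi> (p + q) = free_eval \<chi> p + free_eval \<chi> q"
proof -
  have "finite {w. Poly_Mapping.lookup r w * word_weight \<chi> w \<noteq> 0}" for r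
    by (rule finite_subset[of _ "{w. Poly_Mapping.lookup r w \<noteq> 0}"]) auto
  then show ?thesis
    by (simp add: free_eval_def lookup_add distrib_right Sum_any.distrib)
qed

lemma free_eval_sum: "free_eval \<chi> (sum f S) = (\<Sum>s\<in>S. free_eval \<chi> (f s))"
  by (induction S rule: infinite_finite_induct) (simp_all add: free_eval_zero free_eval_add)

lemma poly_mapping_eq_sum_single:
  "p = (\<Sum>w\<in>Poly_Mapping.keys p. Poly_Mapping.single w (Poly_Mapping.lookup p w))"
  by (rule poly_mapping_eqI)
    (auto simp: lookup_sum lookup_single when_def in_keys_iff)

lemma free_eval_mult: "free_eval \<chi> (p * q) = free_eval \<chi> p * free_eval \<chi> q"
proof -
  let ?s = "\<lambda>p w. Poly_Mapping.single w (Poly_Mapping.lookup p w)"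
  let ?K = "\<lambda>p. Poly_Mapping.keys p"
  have "free_eval \<chi> (sum (?s p) (?K p) * sum (?s q) (?K q))
      = free_eval \<chi> (sum (?s p) (?K p)) * free_eval \<chi> (sum (?s q) (?K q))"
    by (simp add: sum_product free_eval_sum mult_single free_eval_single word_weight_add mult_ac)
  then show ?thesis
    by (simp flip: poly_mapping_eq_sum_single)
qed

lemma free_eval_uminus: "free_eval \<chi> (- p) = - free_eval \<chi> p"
  using free_eval_add[of \<chi> p "- p"] by (simp add: free_eval_zero eq_neg_iff_add_eq_0 add.commute)

lemma free_eval_diff: "free_eval \<chi> (p - q) = free_eval \<chi> p - free_eval \<chi> q"
  using free_eval_add[of \<chi> p "- q"] by (simp add: free_eval_uminus)

lemma free_eval_gen: "free_eval \<chi> (free_gen g) = \<chi> g"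
  by (simp add: free_gen_def free_eval_single word_weight_def)

lemma free_eval_two: "free_eval \<chi> 2 = 2"
  using free_eval_single[of \<chi> 0 2] by (simp add: word_weight_def) (simp add: zero_word_def)

text \<open>The three signs \<open>hat g n\<close> multiply to 1, so each is the product of the
  other two, and in a commutative image every relation reads: twice a product of two signs is twice
  the third.\<close>

lemma free_eval_rel_ideal:
  "a \<in> rel_ideal \<Longrightarrow> free_eval (\<lambda>g. hat g n) a = (0 :: 'k::field)"
proof (induction rule: rel_ideal.induct)
  case (base r p q)
  have "free_eval (\<lambda>g. hat g n) r = (0::'k)"
    using base
    by (cases n) (auto simp: relators_def free_eval_diff free_eval_add free_eval_mult
        free_eval_gen free_eval_two)
  then show ?case by (simp add: free_eval_mult)
qed (simp_all add: free_eval_zero free_eval_add)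

lift_definition character :: "idx \<Rightarrow> 'k::field calA \<Rightarrow> 'k" is "\<lambda>n. free_eval (\<lambda>g. hat g n)"
  using free_eval_rel_ideal by (fastforce simp: free_eval_diff)

lemma character_gen: "character n (genA g) = hat g n"
  by transfer (rule free_eval_gen)

lemma character_add: "character n (a + b) = character n a + character n b"
  by transfer (rule free_eval_add)

lemma character_uminus: "character n (- a) = - character n a"
  by transfer (rule free_eval_uminus)

lemma character_diff: "character n (a - b) = character n a - character n b"
  by transfer (rule free_eval_diff)

lemmas character_simps = character_gen character_add character_uminus character_diff

lemma inj_h: "inj (h :: idx \<Rightarrow> 'k::field_char_0 calA)"
proof (rule injI)
  fix m n :: idx
  assume eq: "(h m :: 'k calA) = h n"
  \<comment> \<open>Extended by a constant entry 1, the four sign vectors are orthogonal of squared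
    length 4; dropping that entry leaves 4 - 1 or 0 - 1.\<close>
  have *: "(character m (h n) :: 'k) = (if m = n then 3 else -1)" for m n
    by (cases m; cases n) (simp_all add: character_simps)
  have "(character m (h m) :: 'k) = character m (h n)" using eq by simp
  then have "(3::'k) = -1 \<or> m = n"
    unfolding * by (auto split: if_splits)
  moreover have "(3::'k) \<noteq> -1"
    by (simp add: eq_neg_iff_add_eq_0)
  ultimately show "m = n" by blast
qed

lemma gens_distinct: "xA \<noteq> (yA :: 'k::field_char_0 calA)" "xA \<noteq> - (yA :: 'k calA)"
proof -
  have neq: "a \<noteq> b" if "character n a \<noteq> character n b" for n and a b :: "'k calA"
    using that by blast
  show "xA \<noteq> (yA :: 'k calA)"
    by (rule neq[of Ix]) (simp add: character_simps)
  show "xA \<noteq> - (yA :: 'k calA)"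
    by (rule neq[of I0]) (simp add: character_simps)
qed

section \<open>Scalars and signs in the algebra\<close>

lemma scaleA_one: "scaleA 1 a = (a :: 'k::field calA)"
  by transfer (simp add: rel_ideal.zero)

lemma scaleA_scaleA: "scaleA c (scaleA d a) = scaleA (c * d) (a :: 'k::field calA)"
  by transfer (simp add: rel_ideal.zero mult_single flip: mult.assoc)

lemma scaleA_minus_one: "scaleA (- 1) a = - (a :: 'k::field calA)"
  by transfer (simp add: rel_ideal.zero single_uminus)

lemma scaleA_two: "scaleA 2 a = 2 * (a :: 'k::field calA)"
proof -
  have "scaleA (1 + 1) a = scaleA 1 a + scaleA 1 a"
    by transfer (simp only: single_add distrib_right diff_self rel_ideal.zero)
  then show ?thesis by (simp add: scaleA_one mult_2)
qed

text \<open>The scalar action divides by 2, which is nonzero in characteristic zero.\<close>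

lemma two_mult_cancel: "2 * a = 2 * b \<Longrightarrow> a = (b :: 'k::field_char_0 calA)"
proof -
  assume "2 * a = 2 * b"
  then have "scaleA (1 / 2) (scaleA 2 a) = scaleA (1 / 2) (scaleA 2 b)"
    by (simp add: scaleA_two)
  then show "a = b" by (simp add: scaleA_scaleA scaleA_one)
qed

text \<open>The generators still satisfy these relations after a permutation and an even number of
  sign changes, so the module arguments are stated for an arbitrary such triple.\<close>

definition rels :: "'k::field calA \<Rightarrow> 'k calA \<Rightarrow> 'k calA \<Rightarrow> bool" where
  "rels a b g \<longleftrightarrow> a * b + b * a = 2 * g \<and> b * g + g * b = 2 * a \<and> g * a + a * g = 2 * b"

lemma rels_gens: "rels xA yA zA"
  using calA_relations by (simp add: rels_def)

lemma rels_swap12: "rels a b g \<Longrightarrow> rels b a g"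
  unfolding rels_def by (simp only: add.commute)

lemma rels_swap23: "rels a b g \<Longrightarrow> rels a g b"
  unfolding rels_def by (simp only: add.commute)

lemma rels_flip: "rels a b g \<Longrightarrow> rels a (- b) (- g)"
proof -
  have neg: "- u - w = - (u + w)" for u w :: "'a calA"
    by simp
  show "rels a b g \<Longrightarrow> rels a (- b) (- g)"
    by (simp add: rels_def neg del: minus_add_distrib)
qed

lemma rels_flip12: "rels a b g \<Longrightarrow> rels (- a) (- b) g"
  by (meson rels_flip rels_swap12 rels_swap23)

definition casimir where "casimir a b g = a * a + b * b + g * (g :: 'k::field calA)"

text \<open>Moving \<open>b\<close> past \<open>a * a\<close> costs 2 (ag - ga) and past
  \<open>g * g\<close> costs 2 (ga - ag); the two cancel. Commutation with \<open>g\<close> then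
  follows by symmetry.\<close>

lemma casimir_commute:
  assumes "rels a b g"
  shows "casimir a b g * b = b * casimir a b g"
proof -
  have r: "a * b = 2 * g - b * a" "g * b = 2 * a - b * g" 
    using assms by (auto simp: rels_def eq_diff_eq add.commute)
  have "a * a * b = a * (2 * g) - (a * b) * a"
    unfolding mult.assoc[of a a b] by (subst r(1)) (simp add: right_diff_distrib mult.assoc)
  also have "\<dots> = a * (2 * g) - 2 * g * a + b * (a * a)"
    unfolding r by (simp add: left_diff_distrib mult.assoc)
  finally have 1: "a * a * b = a * (2 * g) - 2 * g * a + b * (a * a)" .
  have "g * g * b = g * (2 * a) - (g * b) * g"
    unfolding mult.assoc[of g g b] by (subst r(2)) (simp add: right_diff_distrib mult.assoc)
  also have "\<dots> = g * (2 * a) - 2 * a * g + b * (g * g)"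
    unfolding r by (simp add: left_diff_distrib mult.assoc)
  finally have 2: "g * g * b = g * (2 * a) - 2 * a * g + b * (g * g)" .
  show ?thesis
    unfolding casimir_def distrib_left distrib_right 1 2
    unfolding mult_2 by (simp add: algebra_simps)
qed

lemma casimir_swap23: "casimir a g b = casimir a b g"
  by (simp add: casimir_def algebra_simps)

section \<open>Modules\<close>

locale amodule =
  fixes M :: "('k::field, 'v::ab_group_add) amod"
  assumes is_amod: "is_amod M"
begin

sublocale vector_space "smul M"
  using is_amod by (simp add: is_amod_def)

abbreviation scale_op (infixr "\<cdot>" 75) where "c \<cdot> v \<equiv> smul M c v"
abbreviation act_op (infixr "\<rhd>" 75) where "a \<rhd> v \<equiv> act M a v"

lemma subspace_carr: "subspace (carr M)"
  using is_amod by (simp add: is_amod_def)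

lemmas carr_intros [simp, intro] =
  subspace_0[OF subspace_carr] subspace_add[OF subspace_carr] subspace_scale[OF subspace_carr]
  subspace_diff[OF subspace_carr] subspace_neg[OF subspace_carr] subspace_sum[OF subspace_carr]

lemma act_closed [simp, intro]: "v \<in> carr M \<Longrightarrow> a \<rhd> v \<in> carr M"
  using is_amod by (simp add: is_amod_def)

text \<open>Both vectors are assumed in the carrier throughout; items about \<open>v\<close> alone
  are used with \<open>u\<close> set to some vector known to lie there.\<close>

lemma act_simps:
  assumes "u \<in> carr M" "v \<in> carr M"
  shows "a \<rhd> (u + v) = a \<rhd> u + a \<rhd> v"
    and "a \<rhd> c \<cdot> v = c \<cdot> a \<rhd> v"
    and "(a + b) \<rhd> v = a \<rhd> v + b \<rhd> v"
    and "scaleA c a \<rhd> v = c \<cdot> a \<rhd> v"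
    and "(a * b) \<rhd> v = a \<rhd> b \<rhd> v"
    and "1 \<rhd> v = v"
  using is_amod assms by (simp_all add: is_amod_def)

lemma act_zero [simp]: "a \<rhd> 0 = 0"
  using act_simps(1)[of 0 0 a] by simp

lemma act_uminus: "v \<in> carr M \<Longrightarrow> a \<rhd> (- v) = - (a \<rhd> v)"
  using act_simps(1)[of v "- v" a] by (simp add: eq_neg_iff_add_eq_0 add.commute)

lemma act_diff: "u \<in> carr M \<Longrightarrow> v \<in> carr M \<Longrightarrow> a \<rhd> (u - v) = a \<rhd> u - a \<rhd> v"
  using act_simps(1)[of u "- v" a] by (simp add: act_uminus)

lemma uminus_act: "v \<in> carr M \<Longrightarrow> (- a) \<rhd> v = - (a \<rhd> v)"
  using act_simps(4)[of v v "- 1" a] by (simp add: scaleA_minus_one)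

lemma act_sum: "(\<And>i. i \<in> S \<Longrightarrow> f i \<in> carr M) \<Longrightarrow> a \<rhd> sum f S = (\<Sum>i\<in>S. a \<rhd> f i)"
  by (induction S rule: infinite_finite_induct) (auto simp: act_simps)

lemma act_rels:
  assumes "rels a b g" "v \<in> carr M"
  shows "a \<rhd> b \<rhd> v = 2 \<cdot> g \<rhd> v - b \<rhd> a \<rhd> v"
    and "b \<rhd> g \<rhd> v = 2 \<cdot> a \<rhd> v - g \<rhd> b \<rhd> v"
    and "a \<rhd> g \<rhd> v = 2 \<cdot> b \<rhd> v - g \<rhd> a \<rhd> v"
proof -
  have *: "u \<rhd> w \<rhd> v = 2 \<cdot> t \<rhd> v - w \<rhd> u \<rhd> v" if "u * w + w * u = 2 * t" for u w t
  proof -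
    have "(u * w + w * u) \<rhd> v = scaleA 2 t \<rhd> v"
      using that by (simp add: scaleA_two)
    then show ?thesis
      using assms(2) by (simp add: act_simps[where u = v] eq_diff_eq)
  qed
  show "a \<rhd> b \<rhd> v = 2 \<cdot> g \<rhd> v - b \<rhd> a \<rhd> v" "b \<rhd> g \<rhd> v = 2 \<cdot> a \<rhd> v - g \<rhd> b \<rhd> v"
    "a \<rhd> g \<rhd> v = 2 \<cdot> b \<rhd> v - g \<rhd> a \<rhd> v"
    using assms(1) by (auto intro!: * simp: rels_def add.commute)
qed

subsection \<open>Eigenvectors\<close>

lemma eigen_sum_zero:
  assumes "finite S" "\<And>i. i \<in> S \<Longrightarrow> w i \<in> carr M" "\<And>i. i \<in> S \<Longrightarrow> a \<rhd> w i = \<mu> i \<cdot> w i"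
    and "inj_on \<mu> S" "(\<Sum>i\<in>S. w i) = 0"
  shows "\<forall>i\<in>S. w i = 0"
  using assms
proof (induction S arbitrary: w rule: finite_induct)
  case (insert j S)
  have w: "w i \<in> carr M" "a \<rhd> w i = \<mu> i \<cdot> w i" if "i = j \<or> i \<in> S" for i
    using insert.prems that by auto
  have sum: "w j = - (\<Sum>i\<in>S. w i)"
    using insert by (simp add: eq_neg_iff_add_eq_0)
  have "a \<rhd> w j = - (\<Sum>i\<in>S. a \<rhd> w i)"
    unfolding sum using w by (subst act_uminus) (auto simp: act_sum)
  then have "\<mu> j \<cdot> w j = - (\<Sum>i\<in>S. \<mu> i \<cdot> w i)"
    using w by simp
  then have "(\<Sum>i\<in>S. (\<mu> i - \<mu> j) \<cdot> w i) = 0"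
    unfolding sum by (simp add: scale_left_diff_distrib sum_subtractf scale_sum_right)
  moreover have "inj_on \<mu> S"
    using insert.prems by simp
  ultimately have "\<forall>i\<in>S. (\<mu> i - \<mu> j) \<cdot> w i = 0"
    by (intro insert.IH) (auto simp: w act_simps[where u = 0] mult.commute)
  moreover have "\<mu> i \<noteq> \<mu> j" if "i \<in> S" for i
    using insert.prems(3) insert.hyps(2) that by (auto simp: inj_on_def)
  ultimately have "\<forall>i\<in>S. w i = 0"
    by auto
  then show ?case
    using sum by simp
qed simp

text \<open>Comparing \<open>a \<rhd> w\<close> with \<open>\<nu> \<cdot> w\<close> term by term
  kills every summand, as no \<open>\<mu> i\<close> equals \<open>\<nu>\<close>. This is how
  eigenvalues decide boundary conditions later.\<close>

lemma eigen_combination_zero: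
  assumes "finite S" "\<And>i. i \<in> S \<Longrightarrow> u i \<in> carr M" "\<And>i. i \<in> S \<Longrightarrow> a \<rhd> u i = \<mu> i \<cdot> u i"
    and "inj_on \<mu> S" "w = (\<Sum>i\<in>S. k i \<cdot> u i)" "a \<rhd> w = \<nu> \<cdot> w" "\<nu> \<notin> \<mu> ` S"
  shows "w = 0"
proof -
  have "(\<Sum>i\<in>S. (\<mu> i * k i) \<cdot> u i) = (\<Sum>i\<in>S. (\<nu> * k i) \<cdot> u i)"
    using assms(2,3,6) unfolding assms(5)
    by (simp add: act_sum act_simps[where u = 0] scale_sum_right mult.commute)
  then have "(\<Sum>i\<in>S. ((\<mu> i - \<nu>) * k i) \<cdot> u i) = 0"
    by (simp add: scale_left_diff_distrib left_diff_distrib sum_subtractf scale_sum_right)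
  then have "\<forall>i\<in>S. ((\<mu> i - \<nu>) * k i) \<cdot> u i = 0"
    using assms(2,3)
    by (intro eigen_sum_zero[where a = a, OF assms(1) _ _ assms(4)]) (auto simp: act_simps[where u = 0] mult_ac)
  then show ?thesis
    using assms(5,7) by (auto intro!: sum.neutral)
qed

text \<open>Independence comes from the distinct eigenvalues. Spanning is a count: a vector outside
  the span would give d + 2 independent vectors in the span of the d + 1 vectors
  \<open>v i\<close>.\<close>

lemma eigen_basis:
  assumes "is_basis M d v"
    and "\<And>i. i \<le> d \<Longrightarrow> u i \<in> carr M" "\<And>i. i \<le> d \<Longrightarrow> a \<rhd> u i = \<mu> i \<cdot> u i"
    and "\<And>i. i \<le> d \<Longrightarrow> u i \<noteq> 0" "inj_on \<mu> {..d}"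
  shows "inj_on u {..d}" "independent (u ` {..d})" "span (u ` {..d}) = carr M"
proof -
  show inj: "inj_on u {..d}"
  proof (rule inj_onI)
    fix i j assume ij: "i \<in> {..d}" "j \<in> {..d}" "u i = u j"
    then have "\<mu> i \<cdot> u i = a \<rhd> u i" "\<mu> j \<cdot> u i = a \<rhd> u i"
      using assms(3)[of i] assms(3)[of j] ij by (simp_all only: atMost_iff)
    moreover have "u i \<noteq> 0"
      using assms(4) ij by simp
    ultimately have "\<mu> i = \<mu> j"
      by (metis scale_right_imp_eq)
    then show "i = j"
      using assms(5) ij by (simp add: inj_on_def)
  qed
  show indep: "independent (u ` {..d})"
  proof
    assume "dependent (u ` {..d})"
    then obtain k where k: "\<exists>w\<in>u ` {..d}. k w \<noteq> 0" "(\<Sum>w\<in>u ` {..d}. k w \<cdot> w) = 0"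
      by (auto simp: dependent_finite)
    then have "(\<Sum>i\<le>d. k (u i) \<cdot> u i) = 0"
      by (simp add: sum.reindex[OF inj])
    then have "\<forall>i\<in>{..d}. k (u i) \<cdot> u i = 0"
      using assms(2,3)
      by (intro eigen_sum_zero[where \<mu> = \<mu> and a = a, OF _ _ _ assms(5)]) (auto simp: act_simps[where u = 0] mult.commute)
    then show False
      using k(1) assms(4) by auto
  qed
  let ?B = "v ` {0..int d}"
  have v: "inj_on v {0..int d}" "span ?B = carr M"
    using assms(1) by (auto simp: is_basis_def)
  have card: "card ?B = card (u ` {..d})"
    using v(1) inj by (simp add: card_image)
  have sub: "u ` {..d} \<subseteq> carr M"
    using assms(2) by auto
  have "carr M \<subseteq> span (u ` {..d})"
  proof
    fix w assume w: "w \<in> carr M"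
    show "w \<in> span (u ` {..d})"
    proof (rule ccontr)
      assume nw: "w \<notin> span (u ` {..d})"
      then have "independent (insert w (u ` {..d}))"
        using indep by (rule independent_insertI)
      then have "card (insert w (u ` {..d})) \<le> card ?B"
        using w v(2) sub by (intro conjunct2[OF independent_span_bound]) auto
      moreover have "w \<notin> u ` {..d}"
        using nw by (auto intro: span_base)
      ultimately show False
        using card by simp
    qed
  qed
  then show "span (u ` {..d}) = carr M"
    using span_minimal[OF sub subspace_carr] by blast
qed

lemma is_basis_of_nat:
  assumes "inj_on u {..d}" "independent (u ` {..d})" "span (u ` {..d}) = carr M"
  shows "is_basis M d (\<lambda>j. if j < 0 then 0 else u (nat j))"
proof -
  have "(\<lambda>j. if j < 0 then 0 else u (nat j)) ` {0..int d} = u ` nat ` {0..int d}"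
    unfolding image_image by (rule image_cong) auto
  moreover have "{0..int d} = int ` {..d}"
    using image_int_atLeastAtMost[of 0 d] by (simp add: atLeast0AtMost)
  then have "nat ` {0..int d} = {..d}"
    by (simp add: image_image)
  moreover have "inj_on (\<lambda>j. if j < 0 then 0 else u (nat j)) {0..int d}"
    using assms(1) by (auto simp: inj_on_def le_nat_iff) (metis atMost_iff eq_nat_nat_iff nat_le_iff)
  ultimately show ?thesis
    using assms by (simp add: is_basis_def)
qed

lemma span_image_coeffs:
  assumes "inj_on u {..d}" "w \<in> span (u ` {..d::nat})"
  obtains k where "w = (\<Sum>i\<le>d. k i \<cdot> u i)"
proof -
  obtain k where "w = (\<Sum>v\<in>u ` {..d}. k v \<cdot> v)"
    using assms(2) by (auto simp: span_finite)
  then have "w = (\<Sum>i\<le>d. k (u i) \<cdot> u i)"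
    by (simp add: sum.reindex[OF assms(1)])
  then show ?thesis by (rule that)
qed

end

section \<open>Ladders\<close>

text \<open>Indices of equal parity give i = j. Indices of different parity give i + j = E with i +
  j odd, which is excluded by E = d even, and by i + j \<le> 2d when E = 2d + 1.\<close>

lemma inj_on_ladder_eigenvalues:
  assumes "(E = d \<and> even d) \<or> E = 2 * d + 1"
  shows "inj_on (\<lambda>i. (- 1) ^ i * (of_nat E - 2 * of_nat i) :: 'k::field_char_0) {..d}"
proof (rule inj_onI)
  fix i j assume ij: "i \<in> {..d}" "j \<in> {..d}"
    and eq: "(- 1) ^ i * (of_nat E - 2 * of_nat i) = (- 1) ^ j * (of_nat E - 2 * of_nat j :: 'k)"
  have "of_int ((- 1) ^ i * (int E - 2 * int i)) = (of_int ((- 1) ^ j * (int E - 2 * int j)) :: 'k)"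
    using eq by simp
  then have "(- 1) ^ i * (int E - 2 * int i) = (- 1) ^ j * (int E - 2 * int j)"
    by (simp only: of_int_eq_iff)
  then have "i = j \<or> odd (i + j) \<and> i + j = E"
    by (cases "even i"; cases "even j") auto
  then show "i = j"
    using assms ij by auto
qed

text \<open>For even d the left side is d + 2, while all values on the right lie between -d and
  d.\<close>

lemma ladder_eigenvalue_top_notin:
  assumes "even d"
  shows "(- 1) ^ Suc d * (of_nat d - 2 * of_nat (Suc d))
    \<notin> (\<lambda>i. (- 1) ^ i * (of_nat d - 2 * of_nat i) :: 'k::field_char_0) ` {..d}"
proof
  assume "(- 1) ^ Suc d * (of_nat d - 2 * of_nat (Suc d))
    \<in> (\<lambda>i. (- 1) ^ i * (of_nat d - 2 * of_nat i) :: 'k) ` {..d}"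
  then obtain i where i: "i \<le> d"
    "(- 1) ^ Suc d * (of_nat d - 2 * of_nat (Suc d)) = (- 1) ^ i * (of_nat d - 2 * of_nat i :: 'k)"
    by auto
  then have "of_int ((- 1) ^ Suc d * (int d - 2 * int (Suc d))) = (of_int ((- 1) ^ i * (int d - 2 * int i)) :: 'k)"
    by simp
  then have "(- 1) ^ Suc d * (int d - 2 * int (Suc d)) = (- 1) ^ i * (int d - 2 * int i)"
    by (simp only: of_int_eq_iff)
  then show False
    using i(1) assms by (cases "even i") auto
qed

text \<open>Absolute value 2d + 1 is attained only at i = 0, where the sign is positive.\<close>

lemma ladder_eigenvalue_bottom_notin:
  "- of_nat (2 * d + 1)
    \<notin> (\<lambda>i. (- 1) ^ i * (of_nat (2 * d + 1) - 2 * of_nat i) :: 'k::field_char_0) ` {..d}"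
proof
  assume "- of_nat (2 * d + 1)
    \<in> (\<lambda>i. (- 1) ^ i * (of_nat (2 * d + 1) - 2 * of_nat i) :: 'k) ` {..d}"
  then obtain i where i: "i \<le> d"
    "- of_nat (2 * d + 1) = (- 1) ^ i * (of_nat (2 * d + 1) - 2 * of_nat i :: 'k)"
    by auto
  then have "of_int (- int (2 * d + 1)) = (of_int ((- 1) ^ i * (int (2 * d + 1) - 2 * int i)) :: 'k)"
    by simp
  then have "- int (2 * d + 1) = (- 1) ^ i * (int (2 * d + 1) - 2 * int i)"
    by (simp only: of_int_eq_iff)
  then show False
    using i(1) by (cases "even i") auto
qed

text \<open>Both types are ladders with boundary condition \<open>v (d + 1) = c v d\<close>: type \<open>B(d)\<close> has \<open>E = d\<close>,
  \<open>c = 0\<close>, and type \<open>AB(d,n)\<close> has \<open>E = 2 d + 1\<close>, \<open>c = 1\<close> after rescaling the generators by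
  signs.\<close>

definition boundary_param :: "nat \<Rightarrow> nat \<Rightarrow> 'k::field \<Rightarrow> bool" where
  "boundary_param d E c \<longleftrightarrow> c = 0 \<and> E = d \<and> even d \<or> c = 1 \<and> E = 2 * d + 1"

definition prev :: "(nat \<Rightarrow> 'v::zero) \<Rightarrow> nat \<Rightarrow> 'v" where
  "prev p i = (case i of 0 \<Rightarrow> 0 | Suc j \<Rightarrow> p j)"

lemma prev_simps [simp]: "prev p 0 = 0" "prev p (Suc j) = p j"
  by (simp_all add: prev_def)

section \<open>Ladders of vectors and the sums of their rungs\<close>

context amodule
begin

text \<open>The formulas of the models, with \<open>z\<close> arranged so that \<open>y\<close> plus
  or minus (-1)^i \<open>z\<close> isolates the next or the previous vector. The parameter
  \<open>e\<close> may be any scalar.\<close>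

definition rung where
  "rung e x y z p i \<longleftrightarrow> p i \<in> carr M \<and>
     x \<rhd> p i = ((- 1) ^ i * (e - 2 * of_nat i)) \<cdot> p i \<and>
     y \<rhd> p i = (e - of_nat i + 1) \<cdot> prev p i + of_nat (Suc i) \<cdot> p (Suc i) \<and>
     z \<rhd> p i = (- 1) ^ i \<cdot> (of_nat (Suc i) \<cdot> p (Suc i) - (e - of_nat i + 1) \<cdot> prev p i)"

definition ladder where
  "ladder d e c x y z p \<longleftrightarrow> (\<forall>i\<le>d. rung e x y z p i \<and> p i \<noteq> 0) \<and> p (Suc d) = c \<cdot> p d"

text \<open>For 0 < j < m, the vector \<open>p j\<close> receives \<eta>^(j+1) (e - j) from above
  and \<eta>^(j-1) j from below, together \<eta> e times its own coefficient; only the top is left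
  over. The case \<eta> = 1 starts a new ladder, \<eta> = -1 excludes a wrong boundary sign.\<close>

lemma sum_rungs_eigen:
  assumes "\<And>i. i \<le> m \<Longrightarrow> rung e x y z p i" "\<eta> * \<eta> = 1"
  shows "y \<rhd> (\<Sum>i\<le>m. \<eta> ^ i \<cdot> p i) = (\<eta> * e) \<cdot> (\<Sum>i\<le>m. \<eta> ^ i \<cdot> p i)
    + (\<eta> ^ m * of_nat (Suc m)) \<cdot> p (Suc m) - (\<eta> ^ Suc m * (e - of_nat m)) \<cdot> p m"
  using assms(1)
proof (induction m)
  case 0
  then show ?case
    by (simp add: rung_def)
next
  case (Suc m)
  let ?s = "\<Sum>i\<le>m. \<eta> ^ i \<cdot> p i"
  have carr: "?s \<in> carr M" "p (Suc m) \<in> carr M"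
    using Suc.prems by (auto simp: rung_def)
  have "y \<rhd> (?s + \<eta> ^ Suc m \<cdot> p (Suc m)) = y \<rhd> ?s + \<eta> ^ Suc m \<cdot> y \<rhd> p (Suc m)"
    using carr by (simp add: act_simps[where v = "p (Suc m)"] act_simps(1) del: power_Suc)
  also have "y \<rhd> ?s = (\<eta> * e) \<cdot> ?s + (\<eta> ^ m * of_nat (Suc m)) \<cdot> p (Suc m) - (\<eta> ^ Suc m * (e - of_nat m)) \<cdot> p m"
    by (rule Suc.IH) (use Suc.prems in auto)
  also have "y \<rhd> p (Suc m) = (e - of_nat m) \<cdot> p m + of_nat (Suc (Suc m)) \<cdot> p (Suc (Suc m))"
    using Suc.prems[of "Suc m"] by (simp add: rung_def)
  \<comment> \<open>A factor \<eta>^2 = 1 is inserted so that the powers of \<eta> match those of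
    the next step.\<close>
  also have "\<eta> ^ m * of_nat (Suc m) = (\<eta> * \<eta>) * (\<eta> ^ m * of_nat (Suc m))"
    using assms(2) by simp
  finally show ?case
    by (simp add: algebra_simps)
qed

text \<open>Below the top, \<open>x\<close> and \<open>z\<close> both give \<open>p j\<close> the
  coefficient (-1)^j (e - 2j), for \<open>z\<close> split as (e - j) - j.\<close>

lemma sum_rungs_diff:
  assumes "\<And>i. i \<le> m \<Longrightarrow> rung e x y z p i"
  shows "x \<rhd> (\<Sum>i\<le>m. p i) - z \<rhd> (\<Sum>i\<le>m. p i)
    = (- 1) ^ m \<cdot> ((e - of_nat m) \<cdot> p m - of_nat (Suc m) \<cdot> p (Suc m))"
  using assms
proof (induction m)
  case 0
  then show ?case
    by (simp add: rung_def)
next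
  case (Suc m)
  let ?s = "\<Sum>i\<le>m. p i"
  have carr: "?s \<in> carr M" "p (Suc m) \<in> carr M"
    using Suc.prems by (auto simp: rung_def)
  have coeffs: "e - 2 * of_nat (Suc m) = (e - of_nat m) - of_nat (Suc m) - 1"
    "of_nat (Suc (Suc m)) = of_nat (Suc m) + (1 :: 'k)"
    "e - of_nat (Suc m) = (e - of_nat m) - 1"
    by (simp_all add: algebra_simps)
  \<comment> \<open>The inductive step with (-1)^m, e - m and m + 1 abstracted to s, f and n, and
    three consecutive vectors to P, Q and R.\<close>
  have aux: "s \<cdot> (f \<cdot> P - n \<cdot> Q) + ((- 1 * s * (f - n - 1)) \<cdot> Q - (- 1 * s) \<cdot> ((n + 1) \<cdot> R - f \<cdot> P))
    = (- 1 * s) \<cdot> ((f - 1) \<cdot> Q - (n + 1) \<cdot> R)" for s f n P Q R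
    by (simp add: algebra_simps)
  have "x \<rhd> (?s + p (Suc m)) - z \<rhd> (?s + p (Suc m))
      = (x \<rhd> ?s - z \<rhd> ?s) + (x \<rhd> p (Suc m) - z \<rhd> p (Suc m))"
    using carr by (simp add: act_simps(1))
  also have "x \<rhd> ?s - z \<rhd> ?s = (- 1) ^ m \<cdot> ((e - of_nat m) \<cdot> p m - of_nat (Suc m) \<cdot> p (Suc m))"
    by (rule Suc.IH) (use Suc.prems in auto)
  also have "x \<rhd> p (Suc m) = ((- 1) ^ Suc m * (e - 2 * of_nat (Suc m))) \<cdot> p (Suc m)"
    using Suc.prems[of "Suc m"] by (simp add: rung_def)
  also have "z \<rhd> p (Suc m) = (- 1) ^ Suc m \<cdot> (of_nat (Suc (Suc m)) \<cdot> p (Suc (Suc m)) - (e - of_nat m) \<cdot> p m)"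
    using Suc.prems[of "Suc m"] by (simp add: rung_def)
  also have "(- 1) ^ m \<cdot> ((e - of_nat m) \<cdot> p m - of_nat (Suc m) \<cdot> p (Suc m))
      + (((- 1) ^ Suc m * (e - 2 * of_nat (Suc m))) \<cdot> p (Suc m)
        - (- 1) ^ Suc m \<cdot> (of_nat (Suc (Suc m)) \<cdot> p (Suc (Suc m)) - (e - of_nat m) \<cdot> p m))
    = (- 1) ^ Suc m \<cdot> ((e - of_nat (Suc m)) \<cdot> p (Suc m) - of_nat (Suc (Suc m)) \<cdot> p (Suc (Suc m)))"
    unfolding coeffs power_Suc by (rule aux)
  finally show ?case
    by simp
qed

end

section \<open>Chains generated from an extremal eigenvector\<close>

locale amodule_char_0 = amodule M
  for M :: "('k::field_char_0, 'v::ab_group_add) amod"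
begin

text \<open>The relations give a(b + sg) = 2g + 2sb - (b + sg)a, and 2g + 2sb = 2s(b + sg) because
  s^2 = 1.\<close>

lemma raise_eigen:
  assumes "rels a b g" "v \<in> carr M" "a \<rhd> v = l \<cdot> v" "s * s = 1"
  shows "a \<rhd> (b \<rhd> v + s \<cdot> g \<rhd> v) = (2 * s - l) \<cdot> (b \<rhd> v + s \<cdot> g \<rhd> v)"
proof -
  have "a \<rhd> (b \<rhd> v + s \<cdot> g \<rhd> v) = a \<rhd> b \<rhd> v + s \<cdot> a \<rhd> g \<rhd> v"
    using assms(2) by (simp add: act_simps[where u = "b \<rhd> v"])
  also have "\<dots> = (2 \<cdot> g \<rhd> v - l \<cdot> b \<rhd> v) + s \<cdot> (2 \<cdot> b \<rhd> v - l \<cdot> g \<rhd> v)"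
    using assms(1-3) by (simp add: act_rels[OF assms(1)] act_simps[where u = v])
  also have "\<dots> = (2 * s - l) \<cdot> b \<rhd> v + (2 * (s * s) - l * s) \<cdot> g \<rhd> v"
    unfolding assms(4) by (simp add: algebra_simps)
  finally show ?thesis
    by (simp add: algebra_simps)
qed

lemma casimir_act:
  assumes "v \<in> carr M"
  shows "casimir a b g \<rhd> v = a \<rhd> a \<rhd> v + b \<rhd> b \<rhd> v + g \<rhd> g \<rhd> v"
  using assms by (simp add: casimir_def act_simps[where u = v])

lemma casimir_raise:
  assumes "rels a b g" "v \<in> carr M" "casimir a b g \<rhd> v = w \<cdot> v"
  shows "casimir a b g \<rhd> (b \<rhd> v + s \<cdot> g \<rhd> v) = w \<cdot> (b \<rhd> v + s \<cdot> g \<rhd> v)"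
proof -
  have comm: "casimir a b g \<rhd> t \<rhd> v = w \<cdot> t \<rhd> v" if "casimir a b g * t = t * casimir a b g" for t
  proof -
    have "casimir a b g \<rhd> t \<rhd> v = t \<rhd> casimir a b g \<rhd> v"
      using that assms(2) by (simp flip: act_simps(5)[OF assms(2) assms(2)])
    then show ?thesis
      using assms(2,3) by (simp add: act_simps[where u = v])
  qed
  have "casimir a b g * g = g * casimir a b g"
    using casimir_commute[OF rels_swap23[OF assms(1)]] by (simp add: casimir_swap23)
  with casimir_commute[OF assms(1)] show ?thesis
    using assms(2)
    by (simp add: act_simps[where u = "b \<rhd> v"] comm scale_right_distrib mult.commute)
qed

text \<open>Since s^2 = 1 and bg + gb = 2a, the square of b + sg is the Casimir element minus a^2
  plus 2sa, hence a scalar on a common eigenvector.\<close>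

lemma raise_raise:
  assumes "rels a b g" "v \<in> carr M" "a \<rhd> v = l \<cdot> v" "casimir a b g \<rhd> v = w \<cdot> v" "s * s = 1"
  shows "b \<rhd> (b \<rhd> v + s \<cdot> g \<rhd> v) + s \<cdot> g \<rhd> (b \<rhd> v + s \<cdot> g \<rhd> v) = (w - l * l + 2 * s * l) \<cdot> v"
proof -
  have "b \<rhd> (b \<rhd> v + s \<cdot> g \<rhd> v) + s \<cdot> g \<rhd> (b \<rhd> v + s \<cdot> g \<rhd> v)
      = b \<rhd> b \<rhd> v + s \<cdot> (b \<rhd> g \<rhd> v + g \<rhd> b \<rhd> v) + (s * s) \<cdot> g \<rhd> g \<rhd> v"
    using assms(2) by (simp add: act_simps[where u = "b \<rhd> v"] scale_right_distrib add_ac)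
  also have "b \<rhd> g \<rhd> v + g \<rhd> b \<rhd> v = (2 * l) \<cdot> v"
    using act_rels(2)[OF assms(1,2)] assms(3) by simp
  also have "b \<rhd> b \<rhd> v + s \<cdot> (2 * l) \<cdot> v + (s * s) \<cdot> g \<rhd> g \<rhd> v
      = casimir a b g \<rhd> v - a \<rhd> a \<rhd> v + (2 * s * l) \<cdot> v"
    unfolding casimir_act[OF assms(2)] assms(5) by (simp add: mult_ac)
  also have "a \<rhd> a \<rhd> v = (l * l) \<cdot> v"
    using assms(2,3) by (simp add: act_simps[where u = v])
  finally show ?thesis
    by (simp add: assms(4) scale_left_distrib scale_left_diff_distrib)
qed

text \<open>Applies b + g, b - g, b + g, ... in turn; the division makes i + 1 the coefficient of
  the next vector in the action of \<open>b\<close>, as in the models.\<close>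

primrec chain :: "'k calA \<Rightarrow> 'k calA \<Rightarrow> 'v \<Rightarrow> nat \<Rightarrow> 'v" where
  "chain b g u 0 = u"
| "chain b g u (Suc i) =
     inverse (2 * of_nat (Suc i)) \<cdot> (b \<rhd> chain b g u i + (- 1) ^ i \<cdot> g \<rhd> chain b g u i)"

text \<open>The induction carries the eigenvalue of \<open>a\<close>, the eigenvalue of the Casimir
  element, and the lowering formula. Lowering from index i + 1 repeats the operator that raised from
  index i, so \<open>raise_raise\<close> evaluates it.\<close>

lemma rung_chain:
  assumes "rels a b g" "u \<in> carr M" "a \<rhd> u = e \<cdot> u" "b \<rhd> u = g \<rhd> u"
  shows "rung e a b g (chain b g u) i"
proof -
  let ?p = "chain b g u"
  \<comment> \<open>On \<open>u\<close> the actions of \<open>b\<close> and \<open>g\<close> agree,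
    so b^2 + g^2 acts there as bg + gb = 2a, that is, as 2e.\<close>
  let ?w = "e * e + 2 * e"
  have nz: "2 * of_nat (Suc i) \<noteq> (0::'k)" for i
    using of_nat_neq_0[of i, where 'a='k] by (simp del: of_nat_Suc)
  have carr: "?p i \<in> carr M" for i
    by (induction i) (auto simp: assms(2))
  have up: "b \<rhd> ?p i + (- 1) ^ i \<cdot> g \<rhd> ?p i = (2 * of_nat (Suc i)) \<cdot> ?p (Suc i)" for i
    using nz[of i] by (simp del: of_nat_Suc)
  have sq: "(- 1) ^ i * (- 1) ^ i = (1::'k)" for i
    by (simp flip: power_mult_distrib)
  have "a \<rhd> ?p i = ((- 1) ^ i * (e - 2 * of_nat i)) \<cdot> ?p i \<and> casimir a b g \<rhd> ?p i = ?w \<cdot> ?p i \<and>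
    b \<rhd> ?p i - (- 1) ^ i \<cdot> g \<rhd> ?p i = (2 * (e - of_nat i + 1)) \<cdot> prev ?p i"
  proof (induction i)
    case 0
    have "b \<rhd> b \<rhd> u = 2 \<cdot> a \<rhd> u - g \<rhd> g \<rhd> u"
      using act_rels(2)[OF assms(1,2)] assms(4) by simp
    then have "casimir a b g \<rhd> u = ?w \<cdot> u"
      using assms(2,3) by (simp add: casimir_act act_simps[where u = u] scale_left_distrib)
    then show ?case
      using assms by simp
  next
    case (Suc i)
    let ?s = "(- 1) ^ i :: 'k"
    let ?l = "?s * (e - 2 * of_nat i)"
    let ?r = "b \<rhd> ?p i + ?s \<cdot> g \<rhd> ?p i"
    let ?c = "inverse (2 * of_nat (Suc i)) :: 'k"
    have p: "?p (Suc i) = ?c \<cdot> ?r" and r: "?r \<in> carr M"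
      using carr[of i] by auto
    have l: "2 * ?s - ?l = (- 1) ^ Suc i * (e - 2 * of_nat (Suc i))"
      by (simp add: algebra_simps)
    have 1: "a \<rhd> ?p (Suc i) = ((- 1) ^ Suc i * (e - 2 * of_nat (Suc i))) \<cdot> ?p (Suc i)"
      using raise_eigen[OF assms(1) carr conjunct1[OF Suc] sq[of i]] r
      unfolding p l by (simp only: act_simps[where u = ?r] scale_left_commute)
    have 2: "casimir a b g \<rhd> ?p (Suc i) = ?w \<cdot> ?p (Suc i)"
      using casimir_raise[OF assms(1) carr, of i ?w ?s] Suc r
      unfolding p by (simp only: act_simps[where u = ?r] scale_left_commute)
    \<comment> \<open>With l = s(e - 2i) the bracket is e^2 + 2e - (e - 2i)^2 + 2(e - 2i) = 4(i +
      1)(e - i).\<close>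
    have coeff: "?c * (?w - ?l * ?l + 2 * ?s * ?l) = 2 * (e - of_nat i)"
    proof -
      have "?w - ?l * ?l + 2 * ?s * ?l
          = ?w - (?s * ?s) * ((e - 2 * of_nat i) * (e - 2 * of_nat i)) + 2 * (?s * ?s) * (e - 2 * of_nat i)"
        by (simp only: mult_ac)
      also have "\<dots> = (2 * of_nat (Suc i)) * (2 * (e - of_nat i))"
        unfolding sq by (simp add: algebra_simps)
      finally show ?thesis
        using nz[of i] by (simp del: of_nat_Suc)
    qed
    have pull: "b \<rhd> c \<cdot> t - (- 1) ^ Suc i \<cdot> g \<rhd> c \<cdot> t = c \<cdot> (b \<rhd> t + ?s \<cdot> g \<rhd> t)"
      if "t \<in> carr M" for c t
      using that by (simp add: act_simps[where u = t] scale_right_distrib mult.commute)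
    have "b \<rhd> ?p (Suc i) - (- 1) ^ Suc i \<cdot> g \<rhd> ?p (Suc i) = ?c \<cdot> (b \<rhd> ?r + ?s \<cdot> g \<rhd> ?r)"
      unfolding p by (rule pull[OF r])
    also have "\<dots> = (2 * (e - of_nat i)) \<cdot> ?p i"
      unfolding raise_raise[OF assms(1) carr conjunct1[OF Suc] conjunct1[OF conjunct2[OF Suc]] sq[of i]]
      by (simp only: scale_scale coeff)
    finally have 3: "b \<rhd> ?p (Suc i) - (- 1) ^ Suc i \<cdot> g \<rhd> ?p (Suc i) = (2 * (e - of_nat i)) \<cdot> ?p i" .
    show ?case
      using 1 2 3 by simp
  qed
  then have a: "a \<rhd> ?p i = ((- 1) ^ i * (e - 2 * of_nat i)) \<cdot> ?p i"
    and down: "b \<rhd> ?p i - (- 1) ^ i \<cdot> g \<rhd> ?p i = (2 * (e - of_nat i + 1)) \<cdot> prev ?p i"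
    by blast+
  have sign_cancel: "x = s \<cdot> y" if "s \<cdot> x = y" "s * s = 1" for s x y
    using that by auto
  have half: "x = y" if "(2::'k) \<cdot> x = 2 \<cdot> y" for x y
    using that by simp
  \<comment> \<open>Half the sum and half the difference of the raising and lowering formulas give
    the actions of \<open>b\<close> and \<open>g\<close>.\<close>
  have "(2::'k) \<cdot> b \<rhd> ?p i = (2 * (e - of_nat i + 1)) \<cdot> prev ?p i + (2 * of_nat (Suc i)) \<cdot> ?p (Suc i)"
    unfolding up[symmetric] down[symmetric] using scale_left_distrib[of 1 1 "b \<rhd> ?p i"] by simp
  then have b: "b \<rhd> ?p i = (e - of_nat i + 1) \<cdot> prev ?p i + of_nat (Suc i) \<cdot> ?p (Suc i)"
    by - (rule half, simp only: scale_right_distrib scale_scale)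
  have "(2::'k) \<cdot> (- 1) ^ i \<cdot> g \<rhd> ?p i
      = (2 * of_nat (Suc i)) \<cdot> ?p (Suc i) - (2 * (e - of_nat i + 1)) \<cdot> prev ?p i"
    unfolding up[symmetric] down[symmetric]
    using scale_left_distrib[of 1 1 "(- 1) ^ i \<cdot> g \<rhd> ?p i"] by simp
  then have "(- 1) ^ i \<cdot> g \<rhd> ?p i = of_nat (Suc i) \<cdot> ?p (Suc i) - (e - of_nat i + 1) \<cdot> prev ?p i"
    by - (rule half, simp only: scale_right_diff_distrib scale_scale)
  then have "g \<rhd> ?p i = (- 1) ^ i \<cdot> (of_nat (Suc i) \<cdot> ?p (Suc i) - (e - of_nat i + 1) \<cdot> prev ?p i)"
    by (rule sign_cancel) (rule sq)
  with a b carr show ?thesis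
    unfolding rung_def by blast
qed

section \<open>The boundary condition of a chain, and the swap of the first two operators\<close>

lemma double: "(2 * c) \<cdot> v = c \<cdot> v + c \<cdot> v"
  by (simp only: mult_2 scale_left_distrib)

lemma rung_up:
  assumes "rung e x y z p i"
  shows "y \<rhd> p i + (- 1) ^ i \<cdot> z \<rhd> p i = (2 * of_nat (Suc i)) \<cdot> p (Suc i)"
proof -
  have "(- 1) ^ i \<cdot> z \<rhd> p i = of_nat (Suc i) \<cdot> p (Suc i) - (e - of_nat i + 1) \<cdot> prev p i"
    using assms by (simp add: rung_def flip: power_mult_distrib del: of_nat_Suc)
  then show ?thesis
    unfolding double using assms by (simp add: rung_def del: of_nat_Suc)
qed

lemma rung_down:
  assumes "rung e x y z p i"
  shows "y \<rhd> p i - (- 1) ^ i \<cdot> z \<rhd> p i = (2 * (e - of_nat i + 1)) \<cdot> prev p i"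
proof -
  have "(- 1) ^ i \<cdot> z \<rhd> p i = of_nat (Suc i) \<cdot> p (Suc i) - (e - of_nat i + 1) \<cdot> prev p i"
    using assms by (simp add: rung_def flip: power_mult_distrib del: of_nat_Suc)
  then show ?thesis
    unfolding double using assms by (simp add: rung_def del: of_nat_Suc)
qed

text \<open>Lowering from \<open>p (Suc i)\<close> returns 2(e - i) times \<open>p i\<close>, which
  is nonzero.\<close>

lemma rung_nonzero:
  assumes "rung e x y z p (Suc i)" "p i \<noteq> 0" "e \<noteq> of_nat i"
  shows "p (Suc i) \<noteq> 0"
  using rung_down[OF assms(1)] assms(2,3) by auto

text \<open>The old ladder \<open>p\<close> shows that \<open>b\<close> has the same spectrum as
  \<open>a\<close> has on \<open>q\<close>. For E = d, the vector \<open>q (Suc d)\<close> would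
  have an eigenvalue outside the spectrum. For E = 2d + 1 it is a multiple of \<open>q d\<close>;
  going up and down forces the factor to be 1 or -1, and -1 would give \<open>b\<close> the
  eigenvalue -(2d + 1).\<close>

lemma ladder_boundary:
  assumes "rels a b g" "a \<rhd> q 0 = of_nat E \<cdot> q 0" "boundary_param d E c"
    and basis: "is_basis M d v"
    and b_diag: "inj_on p {..d}" "span (p ` {..d}) = carr M"
      "\<And>i. i \<le> d \<Longrightarrow> p i \<in> carr M"
      "\<And>i. i \<le> d \<Longrightarrow> b \<rhd> p i = ((- 1) ^ i * (of_nat E - 2 * of_nat i)) \<cdot> p i"
    and q: "\<And>i. rung (of_nat E) a b g q i" "\<And>i. i \<le> d \<Longrightarrow> q i \<noteq> 0"
  shows "q (Suc d) = c \<cdot> q d"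
proof -
  define \<mu> where "\<mu> i = ((- 1) ^ i * (of_nat E - 2 * of_nat i) :: 'k)" for i
  have inj_\<mu>: "inj_on \<mu> {..d}"
    unfolding \<mu>_def using assms(3) by (intro inj_on_ladder_eigenvalues) (auto simp: boundary_param_def)
  have q_carr: "q i \<in> carr M" and q_eigen: "a \<rhd> q i = \<mu> i \<cdot> q i" for i
    using q(1)[of i] by (auto simp: rung_def \<mu>_def)
  note q_basis = eigen_basis[OF basis, of q a \<mu>, OF q_carr q_eigen q(2) inj_\<mu>]
  obtain k where k: "q (Suc d) = (\<Sum>i\<le>d. k i \<cdot> q i)"
    using q_basis(1,3) q_carr by (metis span_image_coeffs)
  from assms(3) consider "c = 0" "E = d" "even d" | "c = 1" "E = 2 * d + 1"
    by (auto simp: boundary_param_def)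
  then show ?thesis
  proof cases
    case 1
    have "\<mu> (Suc d) \<notin> \<mu> ` {..d}"
      unfolding \<mu>_def 1(2) by (rule ladder_eigenvalue_top_notin[OF 1(3)])
    then have "q (Suc d) = 0"
      by (intro eigen_combination_zero[OF _ q_carr q_eigen inj_\<mu> k q_eigen]) auto
    then show ?thesis
      using 1 by simp
  next
    case 2
    \<comment> \<open>E - 2i is 1 at i = d and -1 at i = d + 1, and the alternating sign evens this
      out.\<close>
    have \<mu>_eq: "\<mu> (Suc d) = \<mu> d"
      by (simp add: \<mu>_def 2 algebra_simps)
    let ?w = "q (Suc d) - k d \<cdot> q d"
    have "?w = (\<Sum>i<d. k i \<cdot> q i)"
      unfolding k by (simp flip: lessThan_Suc_atMost)
    moreover have "a \<rhd> ?w = \<mu> d \<cdot> ?w"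
      using q_carr q_eigen
      by (simp add: act_diff act_simps(2)[where u = 0] \<mu>_eq scale_right_diff_distrib mult.commute)
    moreover have "\<mu> d \<notin> \<mu> ` {..<d}"
      using inj_onD[OF inj_\<mu>, of d] by fastforce
    moreover have "inj_on \<mu> {..<d}"
      using inj_\<mu> by (rule inj_on_subset) auto
    ultimately have "?w = 0"
      by (intro eigen_combination_zero[where S = "{..<d}", OF _ q_carr q_eigen]) auto
    then have k': "q (Suc d) = k d \<cdot> q d"
      by simp
    let ?n = "2 * of_nat (Suc d) :: 'k"
    have n: "?n \<noteq> 0"
      using of_nat_neq_0[of d, where 'a='k] by (simp del: of_nat_Suc)
    \<comment> \<open>For E = 2d + 1 the lowering coefficient 2(E - d) at d + 1 equals the raising
      coefficient 2(d + 1) at d; this yields \<open>k d * k d = 1\<close>.\<close>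
    have "?n \<cdot> q d = b \<rhd> q (Suc d) - (- 1) ^ Suc d \<cdot> g \<rhd> q (Suc d)"
      using rung_down[OF q(1), of "Suc d"] 2 by (simp add: algebra_simps)
    also have "\<dots> = k d \<cdot> (b \<rhd> q d + (- 1) ^ d \<cdot> g \<rhd> q d)"
      unfolding k' using q_carr by (simp add: act_simps[where u = 0] scale_right_distrib mult.commute)
    also have "\<dots> = (k d * ?n * k d) \<cdot> q d"
      unfolding rung_up[OF q(1)] k' by (simp only: scale_scale mult.assoc)
    finally have "(?n * (k d * k d)) \<cdot> q d = (?n * 1) \<cdot> q d"
      by (simp add: mult_ac)
    then have "k d * k d = 1"
      using q(2)[of d] n by (simp del: of_nat_Suc)
    then have "k d = 1 \<or> k d = - 1"
      by (simp add: square_eq_1_iff)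
    moreover have "k d \<noteq> - 1"
    proof
      assume km: "k d = - 1"
      \<comment> \<open>With \<open>k d = - 1\<close> the two boundary terms of the alternating sum
        cancel, so it is an eigenvector of \<open>b\<close> or zero.\<close>
      let ?t = "\<Sum>i\<le>d. (- 1) ^ i \<cdot> q i"
      have "b \<rhd> ?t = (- 1 * of_nat E) \<cdot> ?t + ((- 1) ^ d * of_nat (Suc d)) \<cdot> q (Suc d)
          - ((- 1) ^ Suc d * (of_nat E - of_nat d)) \<cdot> q d"
        by (rule sum_rungs_eigen[OF q(1)]) simp
      also have "((- 1) ^ d * of_nat (Suc d)) \<cdot> q (Suc d) = ((- 1) ^ Suc d * (of_nat E - of_nat d)) \<cdot> q d"
        unfolding k' km 2 by (simp add: algebra_simps)
      finally have t: "b \<rhd> ?t = (- of_nat E) \<cdot> ?t"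
        by simp
      have "?t \<in> carr M"
        using q_carr by auto
      then obtain l where "?t = (\<Sum>i\<le>d. l i \<cdot> p i)"
        using b_diag(1,2) by (metis span_image_coeffs)
      moreover have "- of_nat E \<notin> \<mu> ` {..d}"
        unfolding \<mu>_def 2(2) by (rule ladder_eigenvalue_bottom_notin)
      ultimately have "?t = 0"
        using b_diag(3,4) t inj_\<mu>
        by (intro eigen_combination_zero[where S = "{..d}" and u = p and \<mu> = \<mu> and a = b]) (auto simp: \<mu>_def)
      \<comment> \<open>The summands belong to distinct eigenvalues of \<open>a\<close>, so each
        vanishes, against \<open>q 0\<close> being nonzero.\<close>
      then have "\<forall>i\<in>{..d}. (- 1) ^ i \<cdot> q i = 0"
        using q_carr q_eigen inj_\<mu>
        by (intro eigen_sum_zero[where \<mu> = \<mu> and a = a]) (auto simp: act_simps[where u = 0] mult.commute)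
      then show False
        using q(2)[of 0] by auto
    qed
    ultimately show ?thesis
      using k' 2 by auto
  qed
qed

text \<open>The sum of the old ladder is the bottom of the new one: \<open>y\<close> acts on it by
  E, and \<open>x\<close> and \<open>z\<close> agree on it. It generates a chain of rungs, which
  stay nonzero up to d because i \<noteq> E for i < d.\<close>

lemma ladder_swap12:
  assumes "rels x y z" "is_basis M d v" "ladder d (of_nat E) c x y z p" "boundary_param d E c"
  shows "\<exists>q. ladder d (of_nat E) c y x z q"
proof -
  define \<mu> where "\<mu> i = ((- 1) ^ i * (of_nat E - 2 * of_nat i) :: 'k)" for i
  have inj_\<mu>: "inj_on \<mu> {..d}"
    unfolding \<mu>_def using assms(4) by (intro inj_on_ladder_eigenvalues) (auto simp: boundary_param_def)
  have p: "rung (of_nat E) x y z p i" "p i \<noteq> 0" if "i \<le> d" for i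
    using assms(3) that by (auto simp: ladder_def)
  then have p': "p i \<in> carr M" "x \<rhd> p i = \<mu> i \<cdot> p i" if "i \<le> d" for i
    using that by (auto simp: rung_def \<mu>_def)
  \<comment> \<open>Common form of both boundary cases: 0 = d - d and d + 1 = (2d + 1) - d. It
    removes the leftover top terms of the two sums.\<close>
  have "of_nat (Suc d) * c = of_nat E - of_nat d"
    using assms(4) by (auto simp: boundary_param_def algebra_simps)
  then have top: "of_nat (Suc d) \<cdot> p (Suc d) = (of_nat E - of_nat d) \<cdot> p d"
    using assms(3) by (simp add: ladder_def del: of_nat_Suc)
  let ?u = "\<Sum>i\<le>d. p i"
  let ?q = "chain x z ?u"
  have u: "?u \<in> carr M"
    using p' by auto
  have "?u \<noteq> 0"
    using eigen_sum_zero[of "{..d}" p x \<mu>] p(2)[of 0] p' inj_\<mu> by auto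
  have yu: "y \<rhd> ?u = of_nat E \<cdot> ?u"
    using sum_rungs_eigen[of d "of_nat E" x y z p 1] p(1) top by (simp del: of_nat_Suc)
  have xu: "x \<rhd> ?u = z \<rhd> ?u"
    using sum_rungs_diff[of d "of_nat E" x y z p] p(1) top by (simp del: of_nat_Suc)
  have q: "rung (of_nat E) y x z ?q i" for i
    using rung_chain[OF rels_swap12[OF assms(1)] u yu xu] .
  have q_nz: "?q i \<noteq> 0" if "i \<le> d" for i
    using that
  proof (induction i)
    case 0
    then show ?case using \<open>?u \<noteq> 0\<close> by simp
  next
    case (Suc i)
    have "i \<noteq> E"
      using Suc.prems assms(4) by (auto simp: boundary_param_def)
    then show ?case
      using Suc by (intro rung_nonzero[OF q]) auto
  qed
  \<comment> \<open>The old ladder diagonalizes \<open>x\<close>, which plays the part of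
    \<open>b\<close> for the new one.\<close>
  have "?q (Suc d) = c \<cdot> ?q d"
    using eigen_basis[OF assms(2), of p x \<mu>, OF p' p(2) inj_\<mu>] p'
    by (intro ladder_boundary[OF rels_swap12[OF assms(1)] _ assms(4,2) _ _ _ _ q q_nz, where p = p])
      (auto simp: yu \<mu>_def)
  then show ?thesis
    unfolding ladder_def using q q_nz by blast
qed

end

section \<open>Sign changes and the swap of the last two operators\<close>

lemma sign_square: "((- 1) ^ i * (- 1) ^ i :: 'k::comm_ring_1) = 1"
  by (simp flip: power_mult_distrib)

lemma scaleA_sign_cancel: "scaleA ((- 1) ^ i) (scaleA ((- 1) ^ i) a) = (a :: 'k::field calA)"
  by (simp only: scaleA_scaleA sign_square scaleA_one)

lemma rels_scale_sign:
  assumes "rels a b g"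
  shows "rels (scaleA ((- 1) ^ i) a) (scaleA ((- 1) ^ i) b) g"
  using assms rels_flip12[OF assms] by (cases "even i") (simp_all add: scaleA_one scaleA_minus_one)

primrec ladder_sign :: "'k::field \<Rightarrow> nat \<Rightarrow> 'k" where
  "ladder_sign \<eta> 0 = 1"
| "ladder_sign \<eta> (Suc i) = \<eta> * (- 1) ^ i * ladder_sign \<eta> i"

context amodule_char_0
begin

text \<open>Rescaling by \<open>ladder_sign\<close> absorbs the signs (-1)^i in which
  \<open>y\<close> and \<open>z\<close> differ. At the top the new factor is \<eta> (-1)^d, so this
  choice of \<eta> preserves the boundary constant \<open>c\<close>.\<close>

lemma ladder_swap23:
  assumes "ladder d e c x y z p"
  defines "\<eta> \<equiv> (- 1) ^ d"
  shows "\<exists>q. ladder d e c x (scaleA \<eta> z) (scaleA \<eta> y) q"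
proof -
  let ?s = "ladder_sign \<eta>"
  define q where "q i = ?s i \<cdot> p i" for i
  have \<eta>: "\<eta> * \<eta> = 1"
    unfolding \<eta>_def by (rule sign_square)
  have nz: "?s i \<noteq> 0" for i
    by (induction i) (auto simp: \<eta>_def)
  have prev_q: "prev q i = - ((\<eta> * ?s i * (- 1) ^ i) \<cdot> prev p i)" for i
  proof (cases i)
    case (Suc j)
    have "\<eta> * (\<eta> * (- 1) ^ j * ?s j) * (- 1) ^ Suc j = - ((\<eta> * \<eta>) * ((- 1) ^ j * (- 1) ^ j) * ?s j)"
      by (simp add: mult_ac)
    then show ?thesis
      by (simp add: Suc q_def \<eta> sign_square del: power_Suc)
  qed simp
  have next_q: "q (Suc i) = (\<eta> * ?s i * (- 1) ^ i) \<cdot> p (Suc i)" for i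
    by (simp add: q_def mult_ac)
  have "rung e x (scaleA \<eta> z) (scaleA \<eta> y) q i \<and> q i \<noteq> 0" if "i \<le> d" for i
  proof -
    let ?n = "of_nat (Suc i) :: 'k" and ?f = "e - of_nat i + 1"
    have r: "p i \<in> carr M" "x \<rhd> p i = ((- 1) ^ i * (e - 2 * of_nat i)) \<cdot> p i"
      "y \<rhd> p i = ?f \<cdot> prev p i + ?n \<cdot> p (Suc i)"
      "z \<rhd> p i = (- 1) ^ i \<cdot> (?n \<cdot> p (Suc i) - ?f \<cdot> prev p i)"
      and "p i \<noteq> 0"
      using assms(1) that by (auto simp: ladder_def rung_def)
    have sc: "scaleA \<eta> t \<rhd> q i = (\<eta> * ?s i) \<cdot> t \<rhd> p i" for t
      using r(1) by (simp add: q_def act_simps[where u = 0])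
    have "scaleA \<eta> z \<rhd> q i = ?f \<cdot> prev q i + ?n \<cdot> q (Suc i)"
      unfolding sc r(4) prev_q next_q
      by (simp add: scale_right_diff_distrib mult_ac del: of_nat_Suc)
    moreover have "(- 1) ^ i \<cdot> (?n \<cdot> q (Suc i) - ?f \<cdot> prev q i)
        = ((- 1) ^ i * (- 1) ^ i) \<cdot> (\<eta> * ?s i) \<cdot> (?f \<cdot> prev p i + ?n \<cdot> p (Suc i))"
      unfolding prev_q next_q
      by (simp only: scale_right_diff_distrib scale_right_distrib scale_scale scale_minus_right
          diff_minus_eq_add mult_ac add.commute)
    then have "scaleA \<eta> y \<rhd> q i = (- 1) ^ i \<cdot> (?n \<cdot> q (Suc i) - ?f \<cdot> prev q i)"
      unfolding sc r(3) by (simp only: sign_square scale_one)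
    moreover have "x \<rhd> q i = ((- 1) ^ i * (e - 2 * of_nat i)) \<cdot> q i"
      using r(1,2) by (simp add: q_def act_simps[where u = 0] mult.commute)
    ultimately show ?thesis
      using r(1) nz[of i] \<open>p i \<noteq> 0\<close> unfolding rung_def by (simp add: q_def)
  qed
  moreover have "q (Suc d) = c \<cdot> q d"
    using assms(1) unfolding next_q by (simp add: q_def ladder_def \<eta>_def mult_ac sign_square)
  ultimately show ?thesis
    unfolding ladder_def by blast
qed

text \<open>Alternating the signs of the basis would turn \<open>c\<close> into \<open>- c\<close>,
  hence the restriction to c = 0; for type AB the index \<open>n\<close> absorbs sign changes
  instead.\<close>

lemma ladder_flip:
  assumes "ladder d e 0 x y z p"
  shows "\<exists>q. ladder d e 0 x (- y) (- z) q"
proof -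
  define q where "q i = (- 1) ^ i \<cdot> p i" for i
  have prev_q: "prev q i = - ((- 1) ^ i \<cdot> prev p i)" for i
    by (cases i) (simp_all add: q_def)
  have next_q: "q (Suc i) = - ((- 1) ^ i \<cdot> p (Suc i))" for i
    by (simp add: q_def)
  have "rung e x (- y) (- z) q i \<and> q i \<noteq> 0" if "i \<le> d" for i
  proof -
    have r: "rung e x y z p i" "p i \<noteq> 0"
      using assms that by (auto simp: ladder_def)
    have sc: "(- t) \<rhd> q i = - ((- 1) ^ i \<cdot> t \<rhd> p i)" for t
      using r(1) by (simp add: q_def uminus_act act_simps[where u = 0] rung_def)
    show ?thesis
      using r unfolding rung_def sc prev_q next_q
      by (auto simp: q_def act_simps[where u = 0] scale_right_distrib scale_right_diff_distrib mult_ac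
          simp del: of_nat_Suc)
  qed
  moreover have "q (Suc d) = 0 \<cdot> q d"
    using assms by (simp add: q_def ladder_def)
  ultimately show ?thesis
    unfolding ladder_def by blast
qed

section \<open>Ladders indexed by integers, in the shape of the models\<close>

definition int_ladder where
  "int_ladder d E c x y z v \<longleftrightarrow> is_basis M d v \<and> v (- 1) = 0 \<and> v (int d + 1) = c \<cdot> v (int d) \<and>
     (\<forall>i\<in>{0..int d}.
        x \<rhd> v i = ((- 1) powi i * of_int (int E - 2 * i)) \<cdot> v i \<and>
        y \<rhd> v i = of_int (int E - i + 1) \<cdot> v (i - 1) + of_int (i + 1) \<cdot> v (i + 1) \<and>
        z \<rhd> v i = ((- 1) powi (i - 1) * of_int (int E - i + 1)) \<cdot> v (i - 1)
          + ((- 1) powi i * of_int (i + 1)) \<cdot> v (i + 1))"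

lemma sign_powi_diff: "(- 1) powi (int i - 1) = (- ((- 1) ^ i) :: 'k)"
  by (simp add: power_int_diff)

lemma rung_int_iff:
  "rung (of_nat E) x y z p i \<longleftrightarrow> p i \<in> carr M \<and>
     x \<rhd> p i = ((- 1) powi int i * of_int (int E - 2 * int i)) \<cdot> p i \<and>
     y \<rhd> p i = of_int (int E - int i + 1) \<cdot> prev p i + of_int (int i + 1) \<cdot> p (Suc i) \<and>
     z \<rhd> p i = ((- 1) powi (int i - 1) * of_int (int E - int i + 1)) \<cdot> prev p i
       + ((- 1) powi int i * of_int (int i + 1)) \<cdot> p (Suc i)"
proof -
  have coeffs: "of_int (int E - 2 * int i) = (of_nat E - 2 * of_nat i :: 'k)"
    "of_int (int E - int i + 1) = (of_nat E - of_nat i + 1 :: 'k)"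
    "of_int (int i + 1) = (of_nat (Suc i) :: 'k)"
    by simp_all
  have z: "s \<cdot> (n \<cdot> P - f \<cdot> Q) = (- s * f) \<cdot> Q + (s * n) \<cdot> P" for s n f P Q
    by (simp add: scale_right_diff_distrib)
  show ?thesis
    unfolding rung_def coeffs sign_powi_diff power_int_of_nat z ..
qed

lemma int_ladder_imp_ladder:
  assumes "int_ladder d E c x y z v"
  shows "ladder d (of_nat E) c x y z (\<lambda>i. v (int i))"
proof -
  let ?p = "\<lambda>i. v (int i)"
  have v: "is_basis M d v" "v (- 1) = 0" "v (int d + 1) = c \<cdot> v (int d)"
    using assms by (auto simp: int_ladder_def)
  have "rung (of_nat E) x y z ?p i \<and> ?p i \<noteq> 0" if "i \<le> d" for i
  proof -
    have prev: "v (int i - 1) = prev ?p i"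
      using v(2) by (cases i) simp_all
    have "v (int i) \<in> span (v ` {0..int d})"
      using that by (intro span_base) auto
    then have "v (int i) \<in> carr M"
      using v(1) by (simp add: is_basis_def)
    moreover have "0 \<notin> v ` {0..int d}"
      using v(1) dependent_zero by (auto simp: is_basis_def)
    then have "v (int i) \<noteq> 0"
      using that by force
    moreover have eqs: "x \<rhd> v (int i) = ((- 1) powi int i * of_int (int E - 2 * int i)) \<cdot> v (int i)"
      "y \<rhd> v (int i) = of_int (int E - int i + 1) \<cdot> v (int i - 1) + of_int (int i + 1) \<cdot> v (int i + 1)"
      "z \<rhd> v (int i) = ((- 1) powi (int i - 1) * of_int (int E - int i + 1)) \<cdot> v (int i - 1)
          + ((- 1) powi int i * of_int (int i + 1)) \<cdot> v (int i + 1)"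
      using assms that unfolding int_ladder_def by auto
    moreover have "v (int i + 1) = ?p (Suc i)"
      by (simp add: add.commute)
    ultimately show ?thesis
      unfolding rung_int_iff prev[symmetric] by simp
  qed
  then show ?thesis
    using v(3) by (simp add: ladder_def add.commute)
qed

text \<open>The given basis supplies only the dimension; the ladder itself is a basis by its
  distinct eigenvalues.\<close>

lemma ladder_imp_int_ladder:
  assumes "ladder d (of_nat E) c x y z p" "is_basis M d v" "boundary_param d E c"
  shows "\<exists>v. int_ladder d E c x y z v"
proof -
  define \<mu> where "\<mu> i = ((- 1) ^ i * (of_nat E - 2 * of_nat i) :: 'k)" for i
  have inj_\<mu>: "inj_on \<mu> {..d}"
    unfolding \<mu>_def using assms(3) by (intro inj_on_ladder_eigenvalues) (auto simp: boundary_param_def)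
  have p: "rung (of_nat E) x y z p i" "p i \<noteq> 0" if "i \<le> d" for i
    using assms(1) that by (auto simp: ladder_def)
  let ?v = "\<lambda>j. if j < 0 then 0 else p (nat j)"
  have "is_basis M d ?v"
    using p by (intro is_basis_of_nat eigen_basis[OF assms(2), where a = x and \<mu> = \<mu>] inj_\<mu>)
      (auto simp: rung_def \<mu>_def)
  moreover have "?v (int d + 1) = c \<cdot> ?v (int d)"
    using assms(1) by (simp add: ladder_def nat_add_distrib)
  moreover have "x \<rhd> ?v i = ((- 1) powi i * of_int (int E - 2 * i)) \<cdot> ?v i \<and>
        y \<rhd> ?v i = of_int (int E - i + 1) \<cdot> ?v (i - 1) + of_int (i + 1) \<cdot> ?v (i + 1) \<and>
        z \<rhd> ?v i = ((- 1) powi (i - 1) * of_int (int E - i + 1)) \<cdot> ?v (i - 1)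
          + ((- 1) powi i * of_int (i + 1)) \<cdot> ?v (i + 1)" if i: "i \<in> {0..int d}" for i
  proof -
    obtain n where n: "i = int n" "n \<le> d"
      using i zero_le_imp_eq_int[of i] by auto
    have prev: "?v (int n - 1) = prev p n"
      by (cases n) simp_all
    have "?v (int n) = p n" "?v (int n + 1) = p (Suc n)"
      by (simp_all add: nat_add_distrib)
    then show ?thesis
      using p(1)[OF n(2)] unfolding n(1) rung_int_iff prev by simp
  qed
  ultimately show ?thesis
    unfolding int_ladder_def by (intro exI[of _ ?v]) simp
qed

text \<open>The sign (-1)^d sits on the first two entries, as in type AB. With this normalization
  both adjacent transpositions of the triple preserve the property.\<close>

definition has_ladder where
  "has_ladder d E c a b g \<longleftrightarrow> rels a b g \<and>
     (\<exists>v. int_ladder d E c (scaleA ((- 1) ^ d) a) (scaleA ((- 1) ^ d) b) g v)"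

lemma has_ladder_swap12:
  assumes "has_ladder d E c a b g" "boundary_param d E c"
  shows "has_ladder d E c b a g"
proof -
  obtain v where v: "int_ladder d E c (scaleA ((- 1) ^ d) a) (scaleA ((- 1) ^ d) b) g v"
    using assms(1) by (auto simp: has_ladder_def)
  then have basis: "is_basis M d v"
    by (simp add: int_ladder_def)
  have rel: "rels a b g"
    using assms(1) by (simp add: has_ladder_def)
  then show ?thesis
    using ladder_swap12[OF rels_scale_sign[OF rel] basis int_ladder_imp_ladder[OF v] assms(2)]
      ladder_imp_int_ladder[OF _ basis assms(2)] rels_swap12
    unfolding has_ladder_def by blast
qed

lemma has_ladder_swap23:
  assumes "has_ladder d E c a b g" "boundary_param d E c"
  shows "has_ladder d E c a g b"
proof -
  obtain v where v: "int_ladder d E c (scaleA ((- 1) ^ d) a) (scaleA ((- 1) ^ d) b) g v"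
    using assms(1) by (auto simp: has_ladder_def)
  then have basis: "is_basis M d v"
    by (simp add: int_ladder_def)
  have rel: "rels a b g"
    using assms(1) by (simp add: has_ladder_def)
  obtain q where "ladder d (of_nat E) c (scaleA ((- 1) ^ d) a) (scaleA ((- 1) ^ d) g) b q"
    using ladder_swap23[OF int_ladder_imp_ladder[OF v]] unfolding scaleA_sign_cancel by blast
  then show ?thesis
    using ladder_imp_int_ladder[OF _ basis assms(2)] rels_swap23[OF rel]
    unfolding has_ladder_def by blast
qed

lemma has_ladder_flip:
  assumes "has_ladder d E 0 a b g" "boundary_param d E (0 :: 'k)"
  shows "has_ladder d E 0 a (- b) (- g)"
proof -
  have d: "even d"
    using assms(2) by (simp add: boundary_param_def)
  obtain v where v: "int_ladder d E 0 a b g v"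
    using assms(1) d by (auto simp: has_ladder_def scaleA_one)
  then have basis: "is_basis M d v"
    by (simp add: int_ladder_def)
  have rel: "rels a b g"
    using assms(1) by (simp add: has_ladder_def)
  show ?thesis
    using ladder_flip[OF int_ladder_imp_ladder[OF v]] ladder_imp_int_ladder[OF _ basis assms(2)]
      rels_flip[OF rel] d
    unfolding has_ladder_def by (auto simp: scaleA_one)
qed

end

section \<open>The two models expressed as ladders\<close>

lemma hat_square: "hat g n * hat g n = (1 :: 'k::field)"
  by (cases g; cases n) simp_all

context amodule_char_0
begin

lemma B_model_iff:
  "B_model d M v \<longleftrightarrow> irreducible_amod M \<and> int_ladder d d 0 xA yA zA v"
  by (auto simp: B_model_def int_ladder_def)

lemma eq_sign_scale_iff: "s * s = 1 \<Longrightarrow> w = s \<cdot> u \<longleftrightarrow> s \<cdot> w = u"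
  by (auto simp: scale_scale)

text \<open>The factors \<open>hat g n\<close> and (-1)^d square to 1, so they can be moved from the
  right-hand sides to the generators.\<close>

lemma AB_model_iff:
  "AB_model d n M v \<longleftrightarrow> irreducible_amod M \<and>
     int_ladder d (2 * d + 1) 1 (scaleA ((- 1) ^ d) (scaleA (hat GX n) xA))
       (scaleA ((- 1) ^ d) (scaleA (hat GY n) yA)) (scaleA (hat GZ n) zA) v"
proof -
  let ?\<eta> = "(- 1) ^ d :: 'k"
  have carr: "v i \<in> carr M" if "is_basis M d v" "i \<in> {0..int d}" for i
    using that span_base[of "v i" "v ` {0..int d}"] by (auto simp: is_basis_def)
  have square: "(?\<eta> * hat g n) * (?\<eta> * hat g n) = 1" for g
  proof -
    have "(?\<eta> * hat g n) * (?\<eta> * hat g n) = (?\<eta> * ?\<eta>) * (hat g n * hat g n)"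
      by (simp only: mult_ac)
    then show ?thesis
      by (simp only: sign_square hat_square mult_1)
  qed
  have act: "scaleA ?\<eta> (scaleA c a) \<rhd> u = (?\<eta> * c) \<cdot> a \<rhd> u" "scaleA c a \<rhd> u = c \<cdot> a \<rhd> u"
    if "u \<in> carr M" for a c u
    using that by (simp_all add: act_simps[where u = u])
  have "(xA \<rhd> v i = (hat GX n * (- 1) powi (int d + i) * of_int (2 * int d - 2 * i + 1)) \<cdot> v i \<and>
        yA \<rhd> v i = (hat GY n * (- 1) powi (int d)) \<cdot> (of_int (2 * int d - i + 2) \<cdot> v (i - 1)
             + of_int (i + 1) \<cdot> v (i + 1)) \<and>
        zA \<rhd> v i = hat GZ n \<cdot> (((- 1) powi (i - 1) * of_int (2 * int d - i + 2)) \<cdot> v (i - 1)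
             + ((- 1) powi i * of_int (i + 1)) \<cdot> v (i + 1)))
     \<longleftrightarrow> (scaleA ?\<eta> (scaleA (hat GX n) xA) \<rhd> v i
          = ((- 1) powi i * of_int (int (2 * d + 1) - 2 * i)) \<cdot> v i \<and>
        scaleA ?\<eta> (scaleA (hat GY n) yA) \<rhd> v i
          = of_int (int (2 * d + 1) - i + 1) \<cdot> v (i - 1) + of_int (i + 1) \<cdot> v (i + 1) \<and>
        scaleA (hat GZ n) zA \<rhd> v i
          = ((- 1) powi (i - 1) * of_int (int (2 * d + 1) - i + 1)) \<cdot> v (i - 1)
          + ((- 1) powi i * of_int (i + 1)) \<cdot> v (i + 1))"
    if basis: "is_basis M d v" and i: "i \<in> {0..int d}" for i
  proof -
    have coeffs: "2 * int d - 2 * i + 1 = int (2 * d + 1) - 2 * i" "2 * int d - i + 2 = int (2 * d + 1) - i + 1"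
      by simp_all
    have x: "(hat GX n * (- 1) powi (int d + i) * c) \<cdot> u = (?\<eta> * hat GX n) \<cdot> ((- 1) powi i * c) \<cdot> u" for c u
      by (simp add: power_int_add mult_ac)
    have y: "hat GY n * (- 1) powi (int d) = ?\<eta> * hat GY n"
      by simp
    show ?thesis
      unfolding act(1)[OF carr[OF basis i]]
      unfolding act(2)[OF carr[OF basis i]] coeffs x y eq_sign_scale_iff[OF square]
        eq_sign_scale_iff[OF hat_square] ..
  qed
  then show ?thesis
    unfolding AB_model_def int_ladder_def by (auto simp del: of_int_add of_int_diff hat.simps)
qed

end

section \<open>Automorphisms and twisting\<close>

text \<open>All orders of the generators with an even number of minus signs, given by moves so that
  a property is transported by checking each move.\<close>

inductive signed_perm :: "'k::field calA \<Rightarrow> 'k calA \<Rightarrow> 'k calA \<Rightarrow> bool" where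
  base: "signed_perm xA yA zA"
| swap12: "signed_perm a b g \<Longrightarrow> signed_perm b a g"
| swap23: "signed_perm a b g \<Longrightarrow> signed_perm a g b"
| flip: "signed_perm a b g \<Longrightarrow> signed_perm a (- b) (- g)"

lemma signed_perm_rels: "signed_perm a b g \<Longrightarrow> rels a b g"
  by (induction rule: signed_perm.induct) (auto intro: rels_gens rels_swap12 rels_swap23 rels_flip)

lemma rels_unique: "rels a b g \<Longrightarrow> rels a b g' \<Longrightarrow> g = (g' :: 'k::field_char_0 calA)"
  by (auto simp: rels_def intro: two_mult_cancel)

text \<open>The third generator is left over, and its sign can be chosen to make the number of minus
  signs even. The proof checks four sign patterns in six orders.\<close>

lemma signed_perm_completion:
  assumes "a \<in> {xA, - xA, yA, - yA, zA, - zA}" "b \<in> {xA, - xA, yA, - yA, zA, - zA}"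
    and "a \<noteq> b" "a \<noteq> - b"
  shows "\<exists>g. signed_perm a b g"
proof -
  have perms: "signed_perm a b g" "signed_perm b a g" "signed_perm a g b" "signed_perm g a b"
      "signed_perm b g a" "signed_perm g b a" if "signed_perm a b g" for a b g :: "'a calA"
    using that by (meson signed_perm.swap12 signed_perm.swap23)+
  have signs: "signed_perm xA (- yA) (- zA :: 'a calA)" "signed_perm (- xA) yA (- zA :: 'a calA)"
    "signed_perm (- xA) (- yA) (zA :: 'a calA)" "signed_perm xA yA (zA :: 'a calA)"
    using signed_perm.flip[OF signed_perm.base] signed_perm.base
      perms(2)[OF signed_perm.flip[OF perms(2)[OF signed_perm.base]]]
      perms(2)[OF signed_perm.flip[OF perms(2)[OF signed_perm.flip[OF signed_perm.base]]]]
    by simp_all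
  show ?thesis
    using assms perms[OF signs(1)] perms[OF signs(2)] perms[OF signs(3)] perms[OF signs(4)]
    by (elim insertE emptyE) (simp_all, blast+)
qed

lemma G_inv:
  assumes "\<sigma> \<in> G"
  shows "inv \<sigma> \<in> G"
proof -
  have bij: "bij \<sigma>"
    and im: "\<sigma> ` {xA, - xA, yA, - yA, zA, - zA} = {xA, - xA, yA, - yA, zA, - zA}"
    using assms by (simp_all add: G_def alg_automorphism_def)
  have hom: "\<sigma> 1 = 1" "\<sigma> (a + b) = \<sigma> a + \<sigma> b" "\<sigma> (a * b) = \<sigma> a * \<sigma> b"
      "\<sigma> (scaleA c a) = scaleA c (\<sigma> a)" for a b c
    using assms by (simp_all add: G_def alg_automorphism_def)
  have inv: "inv \<sigma> b = a" if "\<sigma> a = b" for a b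
    using that bij by (auto simp: bij_is_inj)
  have s: "\<sigma> (inv \<sigma> a) = a" for a
    using bij by (simp add: bij_is_surj surj_f_inv_f)
  have "inv \<sigma> ` {xA, - xA, yA, - yA, zA, - zA} = {xA, - xA, yA, - yA, zA, - zA}"
    using image_inv_f_f[OF bij_is_inj[OF bij], of "{xA, - xA, yA, - yA, zA, - zA}"] unfolding im .
  then show ?thesis
    unfolding G_def alg_automorphism_def using bij
    by (auto simp: bij_imp_bij_inv intro!: inv simp: hom s)
qed

text \<open>The images of \<open>xA\<close> and \<open>yA\<close> extend to a signed permutation;
  the relations determine the third entry from the first two, so it is the image of
  \<open>zA\<close>.\<close>

lemma G_signed_perm:
  fixes \<sigma> :: "'k::field_char_0 calA \<Rightarrow> 'k calA"
  assumes "\<sigma> \<in> G"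
  shows "signed_perm (\<sigma> xA) (\<sigma> yA) (\<sigma> zA)"
proof -
  let ?S = "{xA, - xA, yA, - yA, zA, - zA} :: 'k calA set"
  have bij: "bij \<sigma>" and im: "\<sigma> ` ?S = ?S"
    using assms by (simp_all add: G_def alg_automorphism_def)
  have add: "\<sigma> (a + b) = \<sigma> a + \<sigma> b" and mult: "\<sigma> (a * b) = \<sigma> a * \<sigma> b" for a b
    using assms by (simp_all add: G_def alg_automorphism_def)
  have "\<sigma> 0 = 0"
    using add[of 0 0] by simp
  then have minus: "\<sigma> (- a) = - \<sigma> a" for a
    using add[of a "- a"] by (simp add: eq_neg_iff_add_eq_0 add.commute)
  have "\<sigma> xA \<in> ?S" "\<sigma> yA \<in> ?S"
    using im by blast+
  moreover have "\<sigma> xA \<noteq> \<sigma> yA" "\<sigma> xA \<noteq> - \<sigma> yA"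
    using bij gens_distinct[where 'k='k] unfolding minus[symmetric] by (auto dest: bij_is_inj injD)
  ultimately obtain g where g: "signed_perm (\<sigma> xA) (\<sigma> yA) g"
    using signed_perm_completion by blast
  have "\<sigma> (xA * yA + yA * xA) = \<sigma> (zA + zA)" "\<sigma> (yA * zA + zA * yA) = \<sigma> (xA + xA)"
    "\<sigma> (zA * xA + xA * zA) = \<sigma> (yA + yA)"
    by (simp_all only: calA_relations mult_2)
  then have "rels (\<sigma> xA) (\<sigma> yA) (\<sigma> zA)"
    by (simp add: rels_def add mult mult_2)
  then show ?thesis
    using g rels_unique signed_perm_rels by blast
qed

text \<open>Tracks the index: \<open>m\<close> is found along the moves so that its signs turn the
  triple into a mere permutation of the terms of \<open>h n\<close>. The property \<open>P\<close>,
  later \<open>has_ladder\<close>, therefore has to survive only transpositions.\<close>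

lemma G_signed_hats:
  fixes a b g :: "'k::field calA"
  assumes "signed_perm a b g"
  shows "\<exists>m. scaleA (hat GX m) a + scaleA (hat GY m) b + scaleA (hat GZ m) g = h n \<and>
    (\<forall>P. P (scaleA (hat GX n) xA) (scaleA (hat GY n) yA) (scaleA (hat GZ n) zA) \<longrightarrow>
       (\<forall>a b g. P a b g \<longrightarrow> P b a g) \<longrightarrow> (\<forall>a b g. P a b g \<longrightarrow> P a g b) \<longrightarrow>
       P (scaleA (hat GX m) a) (scaleA (hat GY m) b) (scaleA (hat GZ m) g))"
  using assms
proof (induction rule: signed_perm.induct)
  case base
  show ?case
    by (rule exI[of _ n]) (cases n; simp add: scaleA_one scaleA_minus_one)
next
  case (swap12 a b g)
  then obtain m where m: "scaleA (hat GX m) a + scaleA (hat GY m) b + scaleA (hat GZ m) g = h n"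
    "\<And>P. P (scaleA (hat GX n) xA) (scaleA (hat GY n) yA) (scaleA (hat GZ n) zA) \<Longrightarrow>
       (\<forall>a b g. P a b g \<longrightarrow> P b a g) \<Longrightarrow> (\<forall>a b g. P a b g \<longrightarrow> P a g b) \<Longrightarrow>
       P (scaleA (hat GX m) a) (scaleA (hat GY m) b) (scaleA (hat GZ m) g)"
    by blast
  obtain l where l: "(hat GX l :: 'k) = hat GY m" "(hat GY l :: 'k) = hat GX m" "(hat GZ l :: 'k) = hat GZ m"
    by (cases m) (force intro: that[of I0] that[of Ix] that[of Iy] that[of Iz])+
  show ?case
    using m(1) by (intro exI[of _ l] conjI allI impI; unfold l) (simp add: add_ac, use m(2) in blast)
next
  case (swap23 a b g)
  then obtain m where m: "scaleA (hat GX m) a + scaleA (hat GY m) b + scaleA (hat GZ m) g = h n"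
    "\<And>P. P (scaleA (hat GX n) xA) (scaleA (hat GY n) yA) (scaleA (hat GZ n) zA) \<Longrightarrow>
       (\<forall>a b g. P a b g \<longrightarrow> P b a g) \<Longrightarrow> (\<forall>a b g. P a b g \<longrightarrow> P a g b) \<Longrightarrow>
       P (scaleA (hat GX m) a) (scaleA (hat GY m) b) (scaleA (hat GZ m) g)"
    by blast
  obtain l where l: "(hat GX l :: 'k) = hat GX m" "(hat GY l :: 'k) = hat GZ m" "(hat GZ l :: 'k) = hat GY m"
    by (cases m) (force intro: that[of I0] that[of Ix] that[of Iy] that[of Iz])+
  show ?case
    using m(1) by (intro exI[of _ l] conjI allI impI; unfold l) (simp add: add_ac, use m(2) in blast)
next
  case (flip a b g)
  then obtain m where m: "scaleA (hat GX m) a + scaleA (hat GY m) b + scaleA (hat GZ m) g = h n"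
    "\<And>P. P (scaleA (hat GX n) xA) (scaleA (hat GY n) yA) (scaleA (hat GZ n) zA) \<Longrightarrow>
       (\<forall>a b g. P a b g \<longrightarrow> P b a g) \<Longrightarrow> (\<forall>a b g. P a b g \<longrightarrow> P a g b) \<Longrightarrow>
       P (scaleA (hat GX m) a) (scaleA (hat GY m) b) (scaleA (hat GZ m) g)"
    by blast
  \<comment> \<open>The index l exchanges I0 with Ix and Iy with Iz, so the signs cancel and the
    scaled triple is unchanged.\<close>
  obtain l where l: "(hat GX l :: 'k) = hat GX m" "(hat GY l :: 'k) = - hat GY m" "(hat GZ l :: 'k) = - hat GZ m"
    by (cases m) (force intro: that[of I0] that[of Ix] that[of Iy] that[of Iz])+
  have neg: "scaleA (- c) (- t) = scaleA c t" for c and t :: "'k calA"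
    using scaleA_scaleA[of "- c" "- 1" t] by (simp add: scaleA_minus_one)
  show ?case
    using m(1) by (intro exI[of _ l] conjI allI impI; unfold l neg) (simp, use m(2) in blast)
qed

text \<open>Applying \<open>\<sigma>\<close> to the expression of \<open>h n\<close> in the elements
  \<open>inv \<sigma> xA\<close>, \<open>inv \<sigma> yA\<close>, \<open>inv \<sigma> zA\<close>
  replaces them by the generators and yields \<open>h m\<close>.\<close>

lemma G_inv_h:
  assumes "\<sigma> \<in> (G :: ('k::field_char_0 calA \<Rightarrow> 'k calA) set)"
  obtains m where "\<sigma> (h n) = h m"
    "\<And>P. P (scaleA (hat GX n) xA) (scaleA (hat GY n) yA) (scaleA (hat GZ n) zA) \<Longrightarrow>
       (\<forall>a b g. P a b g \<longrightarrow> P b a g) \<Longrightarrow> (\<forall>a b g. P a b g \<longrightarrow> P a g b) \<Longrightarrow>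
       P (scaleA (hat GX m) (inv \<sigma> xA)) (scaleA (hat GY m) (inv \<sigma> yA)) (scaleA (hat GZ m) (inv \<sigma> zA))"
proof -
  have hom: "\<sigma> (a + b) = \<sigma> a + \<sigma> b" "\<sigma> (scaleA c a) = scaleA c (\<sigma> a)" for a b c
    using assms by (simp_all add: G_def alg_automorphism_def)
  have s: "\<sigma> (inv \<sigma> a) = a" for a
    using assms by (simp add: G_def alg_automorphism_def bij_is_surj surj_f_inv_f)
  obtain m where m: "scaleA (hat GX m) (inv \<sigma> xA) + scaleA (hat GY m) (inv \<sigma> yA)
      + scaleA (hat GZ m) (inv \<sigma> zA) = h n"
    "\<And>P. P (scaleA (hat GX n) xA) (scaleA (hat GY n) yA) (scaleA (hat GZ n) zA) \<Longrightarrow>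
       (\<forall>a b g. P a b g \<longrightarrow> P b a g) \<Longrightarrow> (\<forall>a b g. P a b g \<longrightarrow> P a g b) \<Longrightarrow>
       P (scaleA (hat GX m) (inv \<sigma> xA)) (scaleA (hat GY m) (inv \<sigma> yA)) (scaleA (hat GZ m) (inv \<sigma> zA))"
    using G_signed_hats[OF G_signed_perm[OF G_inv[OF assms]], of n] by blast
  have "\<sigma> (h n) = scaleA (hat GX m) xA + scaleA (hat GY m) yA + scaleA (hat GZ m) zA"
    by (simp add: m(1)[symmetric] hom s)
  also have "\<dots> = h m"
    by (cases m) (simp_all add: scaleA_one scaleA_minus_one)
  finally show ?thesis
    using m(2) by (rule that)
qed

lemma finite_UNIV_idx: "finite (UNIV :: idx set)"
proof -
  have "UNIV = {I0, Ix, Iy, Iz}"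
    using idx.exhaust by auto
  then show ?thesis
    by (metis finite.emptyI finite.insertI)
qed

text \<open>Justifies the definite description: injectivity of \<open>\<sigma>\<close> and
  \<open>h\<close> makes the index map injective, hence a permutation of a finite set, and
  unique.\<close>

lemma tilde_eqI:
  assumes "\<sigma> \<in> (G :: ('k::field_char_0 calA \<Rightarrow> 'k calA) set)" "\<sigma> (h n) = h m"
  shows "tilde \<sigma> n = m"
proof -
  have "\<exists>m. \<sigma> (h n) = h m" for n
    using G_inv_h[OF assms(1)] by metis
  then obtain \<pi> where \<pi>: "\<sigma> (h n) = h (\<pi> n)" for n
    by metis
  have "inj \<sigma>"
    using assms(1) by (simp add: G_def alg_automorphism_def bij_is_inj)
  then have "inj \<pi>"
    using inj_h[where 'k='k] \<pi> by (metis injD injI)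
  then have "bij \<pi>"
    using finite_UNIV_idx by (simp add: bij_def finite_UNIV_inj_surj)
  then have perm: "\<pi> permutes UNIV"
    by (simp add: permutes_def bij_iff)
  have uniq: "\<rho> = \<pi>" if "\<forall>n. \<sigma> (h n) = h (\<rho> n)" for \<rho>
    using that \<pi> inj_h[where 'k='k] by (metis ext injD)
  have "tilde \<sigma> = \<pi>"
    unfolding tilde_def using perm \<pi> uniq by (intro the_equality) auto
  then show ?thesis
    using assms(2) \<pi> inj_h[where 'k='k] by (metis injD)
qed

section \<open>Twisted modules and twisted models\<close>

lemma is_amod_twist:
  assumes "is_amod M" "\<sigma> \<in> G"
  shows "is_amod (twist \<sigma> M)"
proof -
  have "inv \<sigma> 1 = 1" "inv \<sigma> (a + b) = inv \<sigma> a + inv \<sigma> b" "inv \<sigma> (a * b) = inv \<sigma> a * inv \<sigma> b"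
      "inv \<sigma> (scaleA c a) = scaleA c (inv \<sigma> a)" for a b c
    using G_inv[OF assms(2)] by (simp_all add: G_def alg_automorphism_def)
  then show ?thesis
    using assms(1) by (simp add: is_amod_def twist_def)
qed

lemma irreducible_amod_twist:
  assumes "irreducible_amod M" "\<sigma> \<in> G"
  shows "irreducible_amod (twist \<sigma> M)"
proof -
  have "inv \<sigma> (\<sigma> a) = a" for a
    using assms(2) by (simp add: G_def alg_automorphism_def bij_is_inj)
  then have "submod U (twist \<sigma> M) \<longleftrightarrow> submod U M" for U
    unfolding submod_def twist_def by simp metis
  then show ?thesis
    using assms is_amod_twist by (auto simp: irreducible_amod_def) (auto simp: twist_def)
qed

lemma amod_iso_twist: "amod_iso M N \<Longrightarrow> amod_iso (twist \<sigma> M) (twist \<sigma> N)"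
  unfolding amod_iso_def twist_def by auto

lemma int_ladder_twist:
  assumes "is_amod M" "\<sigma> \<in> G"
  shows "amodule_char_0.int_ladder (twist \<sigma> M) d E c x y z v
    \<longleftrightarrow> amodule_char_0.int_ladder M d E c (inv \<sigma> x) (inv \<sigma> y) (inv \<sigma> z) v"
proof -
  interpret M: amodule_char_0 M
    by unfold_locales (rule assms(1))
  interpret T: amodule_char_0 "twist \<sigma> M"
    by unfold_locales (rule is_amod_twist[OF assms])
  show ?thesis
    unfolding M.int_ladder_def T.int_ladder_def by (simp add: is_basis_def twist_def)
qed

text \<open>Type B carries no index: all moves generating the signed permutations, sign changes
  included, preserve \<open>has_ladder\<close> when c = 0.\<close>

lemma B_model_twist:
  fixes M :: "('k::field_char_0, 'v::ab_group_add) amod"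
  assumes "B_model d M v" "even d" "\<sigma> \<in> G"
  shows "\<exists>v. B_model d (twist \<sigma> M) v"
proof -
  have irr: "irreducible_amod M" and amod: "is_amod M"
    using assms(1) by (auto simp: B_model_def irreducible_amod_def)
  interpret M: amodule_char_0 M
    by unfold_locales (rule amod)
  interpret T: amodule_char_0 "twist \<sigma> M"
    by unfold_locales (rule is_amod_twist[OF amod assms(3)])
  have param: "boundary_param d d (0 :: 'k)"
    using assms(2) by (simp add: boundary_param_def)
  have base: "M.has_ladder d d 0 xA yA zA"
    using assms(1,2) rels_gens by (auto simp: M.has_ladder_def M.B_model_iff scaleA_one)
  have "M.has_ladder d d 0 a b g" if "signed_perm a b g" for a b g
    using that
    by (induction rule: signed_perm.induct)
      (blast intro: base M.has_ladder_swap12 M.has_ladder_swap23 M.has_ladder_flip param)+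
  then have "M.has_ladder d d 0 (inv \<sigma> xA) (inv \<sigma> yA) (inv \<sigma> zA)"
    using G_signed_perm[OF G_inv[OF assms(3)]] .
  then show ?thesis
    using assms(2) irreducible_amod_twist[OF irr assms(3)]
    by (auto simp: M.has_ladder_def T.B_model_iff int_ladder_twist[OF amod assms(3)] scaleA_one)
qed

text \<open>Here \<open>has_ladder\<close> for the signed triple is the property followed by
  \<open>G_inv_h\<close>, and the index found there is \<open>tilde \<sigma> n\<close>.\<close>

lemma AB_model_twist:
  fixes M :: "('k::field_char_0, 'v::ab_group_add) amod"
  assumes "AB_model d n M v" "\<sigma> \<in> G"
  shows "\<exists>v. AB_model d (tilde \<sigma> n) (twist \<sigma> M) v"
proof -
  have irr: "irreducible_amod M" and amod: "is_amod M"
    using assms(1) by (auto simp: AB_model_def irreducible_amod_def)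
  interpret M: amodule_char_0 M
    by unfold_locales (rule amod)
  interpret T: amodule_char_0 "twist \<sigma> M"
    by unfold_locales (rule is_amod_twist[OF amod assms(2)])
  let ?L = "M.has_ladder d (2 * d + 1) 1"
  have param: "boundary_param d (2 * d + 1) (1 :: 'k)"
    by (simp add: boundary_param_def)
  have inv_scale: "inv \<sigma> (scaleA c a) = scaleA c (inv \<sigma> a)" for c a
    using G_inv[OF assms(2)] by (simp add: G_def alg_automorphism_def)
  obtain m where m: "\<sigma> (h n) = h m"
    "\<And>P. P (scaleA (hat GX n) xA) (scaleA (hat GY n) yA) (scaleA (hat GZ n) zA) \<Longrightarrow>
       (\<forall>a b g. P a b g \<longrightarrow> P b a g) \<Longrightarrow> (\<forall>a b g. P a b g \<longrightarrow> P a g b) \<Longrightarrow>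
       P (scaleA (hat GX m) (inv \<sigma> xA)) (scaleA (hat GY m) (inv \<sigma> yA)) (scaleA (hat GZ m) (inv \<sigma> zA))"
    using G_inv_h[OF assms(2), of n] by metis
  have "rels (scaleA (hat GX n) xA) (scaleA (hat GY n) yA) (scaleA (hat GZ n) (zA :: 'k calA))"
  proof -
    have "rels (- xA) yA (- zA :: 'k calA)"
      using rels_swap12[OF rels_flip[OF rels_swap12[OF rels_gens]]] .
    then show ?thesis
      using rels_gens rels_flip[OF rels_gens] rels_flip12[OF rels_gens]
      by (cases n) (simp_all add: scaleA_one scaleA_minus_one)
  qed
  then have "?L (scaleA (hat GX n) xA) (scaleA (hat GY n) yA) (scaleA (hat GZ n) zA)"
    using assms(1) unfolding M.has_ladder_def M.AB_model_iff by blast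
  then have "?L (scaleA (hat GX m) (inv \<sigma> xA)) (scaleA (hat GY m) (inv \<sigma> yA)) (scaleA (hat GZ m) (inv \<sigma> zA))"
    using M.has_ladder_swap12[OF _ param] M.has_ladder_swap23[OF _ param]
    by (intro m(2)[of ?L]) blast+
  then show ?thesis
    using irreducible_amod_twist[OF irr assms(2)]
    unfolding M.has_ladder_def T.AB_model_iff int_ladder_twist[OF amod assms(2)]
      tilde_eqI[OF assms(2) m(1)] inv_scale by blast
qed

theorem theorem4p2:
  fixes V :: "('k::{alg_closed_field, field_char_0}, 'v::ab_group_add) amod"
    and \<sigma> :: "'k calA \<Rightarrow> 'k calA"
    and d :: nat
  assumes "finite_dim V" and "irreducible_amod V" and "diameter V = d" and "\<sigma> \<in> G"
  shows "(type_B d V \<longrightarrow> type_B d (twist \<sigma> V)) \<and>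
         (\<forall>n. type_AB d n V \<longrightarrow> type_AB d (tilde \<sigma> n) (twist \<sigma> V))"
proof (intro conjI impI allI)
  show "type_B d (twist \<sigma> V)" if "type_B d V"
    using that B_model_twist amod_iso_twist is_amod_twist assms(4) unfolding type_B_def by metis
  show "type_AB d (tilde \<sigma> n) (twist \<sigma> V)" if "type_AB d n V" for n
    using that AB_model_twist amod_iso_twist is_amod_twist assms(4) unfolding type_AB_def by metis
qed

end
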